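(* Let $Q>1$, let $Z=(Z,d,\mu)$ be an Ahlfors $Q$-regular compact metric measure space with $\operatorname{diam}(Z)=1$ that supports a $Q$-Poincaré inequality, and let $X=(V,E)$ be a hyperbolic filling of $Z$, used to define $\dot A^p(Z)$. Then for $1<p<Q$ the space $\dot A^p(Z)$ consists only of (almost everywhere) constant functions.
   Context: Ahlfors regularity: a metric space $(Z,d)$ with a Borel measure $\mu$ is Ahlfors $Q$-regular (with $\operatorname{diam}(Z)=1$) if there is a constant $c\ge 1$ with $c^{-1}r^Q\le\mu(B)\le c\,r^Q$ for every open ball $B$ of radius $0<r\le 1$. Write $|A|=\mu(A)$ and $f_B=\frac1{|B|}\int_Bf\,d\mu$; $\Lambda B$ is the ball with the same center as $B$ and $\Lambda$ times its radius. Poincaré inequality: for Lipschitz $f\colon Z\to\mathbb{R}$ let $(\operatorname{Lip} f)(x)=\limsup_{r\to0^+}\sup_{y\in B(x,r)}|f(y)-f(x)|/r$. For $p\ge1$, $Z$ supports a $p$-Poincaré inequality if there are $C\ge0$, $\Lambda\ge1$ such that $\frac1{|B|}\int_B|f-f_B|\,d\mu\le CR\big(\frac1{|\Lambda B|}\int_{\Lambda B}(\operatorname{Lip}f)^p\,d\mu\big)^{1/p}$ for every Lipschitz $f\colon Z\to\mathbb{R}$ and every ball $B\subset Z$, where $R$ is the radius of $B$. Hyperbolic filling: for each $n\in\mathbb{N}=\{1,2,\dots\}$ choose a maximal $2^{-n}$-separated set $Z_n\subset Z$. Let $V_n$ be the collection of balls $B(z,2^{1-n})$, $z\in Z_n$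 (level $n$), and $V_0=\{Z\}$ (level $0$). The vertex set $V$ is the disjoint union of the $V_n$, $n\ge 0$. Two distinct vertices $B,B'$ are joined by an (unoriented, unique) edge if their levels differ by at most $1$ and $B\cap B'\ne\emptyset$; $E$ is the set of edges. For each edge $e$ one fixes a choice of initial vertex $e_-$ and terminal vertex $e_+$ among its two endpoints. For $f\in L^1(Z)$ (real-valued), the Poisson extension $Pf\colon V\to\mathbb{R}$ is $Pf(B)=f_B$; for $u\colon V\to\mathbb{R}$, $du(e)=u(e_+)-u(e_-)$, $e\in E$. For a countable set $M$ and $p>1$, $\ell^{p,\infty}(M)$ is the space of all $s\colon M\to\mathbb{R}$ for which there is $C\ge0$ with $\#\{m\in M:|s(m)|>\lambda\}\le (C/\lambda)^p$ for all $\lambda>0$. $\dot A^p(Z)$ is the space of all $f\in L^1(Z)$ with $d(Pf)\in\ell^{p,\infty}(E)$. *)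

theory Defs
  imports "HOL-Analysis.Analysis"
begin

text \<open>
  The metric space \<open>Z\<close> is the whole type \<open>'a :: metric_space\<close>. Balls are open and carry
  their centre and radius as data.
\<close>

definition ahlfors_regular :: "'a::metric_space measure \<Rightarrow> real \<Rightarrow> bool" where
  "ahlfors_regular \<mu> Q \<longleftrightarrow>
     (\<exists>c\<ge>1. \<forall>z r. 0 < r \<and> r \<le> 1 \<longrightarrow>
        ennreal (inverse c * r powr Q) \<le> emeasure \<mu> (ball z r) \<and>
        emeasure \<mu> (ball z r) \<le> ennreal (c * r powr Q))"

definition mean :: "'a measure \<Rightarrow> 'a set \<Rightarrow> ('a \<Rightarrow> real) \<Rightarrow> real" where
  "mean \<mu> B f = (LINT x:B|\<mu>. f x) / measure \<mu> B"

text \<open>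
  The limsup and the supremum are taken in the extended reals; for Lipschitz \<open>f\<close> both are
  finite, so the conversion to a real number loses nothing.
\<close>

definition Lip :: "('a::metric_space \<Rightarrow> real) \<Rightarrow> 'a \<Rightarrow> real" where
  "Lip f x = real_of_ereal
     (Limsup (at_right 0) (\<lambda>r. SUP y\<in>ball x r. ereal (\<bar>f y - f x\<bar> / r)))"

definition poincare_inequality :: "'a::metric_space measure \<Rightarrow> real \<Rightarrow> bool" where
  "poincare_inequality \<mu> p \<longleftrightarrow>
     (\<exists>C\<ge>0. \<exists>\<Lambda>\<ge>1. \<forall>f z R. (\<exists>L. L-lipschitz_on UNIV f) \<and> 0 < R \<longrightarrow>
        mean \<mu> (ball z R) (\<lambda>x. \<bar>f x - mean \<mu> (ball z R) f\<bar>)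
          \<le> C * R * (mean \<mu> (ball z (\<Lambda> * R)) (\<lambda>x. Lip f x powr p)) powr (1 / p))"

definition separated :: "real \<Rightarrow> 'a::metric_space set \<Rightarrow> bool" where
  "separated \<epsilon> A \<longleftrightarrow> (\<forall>x\<in>A. \<forall>y\<in>A. x \<noteq> y \<longrightarrow> \<epsilon> \<le> dist x y)"

definition maximal_separated :: "real \<Rightarrow> 'a::metric_space set \<Rightarrow> bool" where
  "maximal_separated \<epsilon> A \<longleftrightarrow>
     separated \<epsilon> A \<and> (\<forall>A'. separated \<epsilon> A' \<and> A \<subseteq> A' \<longrightarrow> A' = A)"

text \<open>
  \<open>Root\<close> is the vertex \<open>Z\<close> of level \<open>0\<close>, and \<open>Cell n z\<close> is the ball \<open>B(z, 2\<^sup>1\<^sup>-\<^sup>n)\<close> as a vertex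
  of level \<open>n\<close>. Thus balls with different centres are different vertices, even if they coincide
  as point sets.
\<close>

datatype 'a vertex = Root | Cell nat 'a

fun level :: "'a vertex \<Rightarrow> nat" where
  "level Root = 0"
| "level (Cell n z) = n"

fun vset :: "'a::metric_space vertex \<Rightarrow> 'a set" where
  "vset Root = UNIV"
| "vset (Cell n z) = ball z (2 powi (1 - int n))"

text \<open>
  Below, \<open>N n\<close> is the chosen maximal separated set of level \<open>n \<ge> 1\<close>; \<open>N 0\<close> is irrelevant.
\<close>

definition filling_nets :: "(nat \<Rightarrow> 'a::metric_space set) \<Rightarrow> bool" where
  "filling_nets N \<longleftrightarrow> (\<forall>n\<ge>1. maximal_separated (2 powi (- int n)) (N n))"

definition vertices :: "(nat \<Rightarrow> 'a set) \<Rightarrow> 'a vertex set" where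
  "vertices N = insert Root {Cell n z | n z. 1 \<le> n \<and> z \<in> N n}"

definition edges :: "(nat \<Rightarrow> 'a::metric_space set) \<Rightarrow> 'a vertex set set" where
  "edges N = {{v, w} | v w. v \<in> vertices N \<and> w \<in> vertices N \<and> v \<noteq> w \<and>
     \<bar>int (level v) - int (level w)\<bar> \<le> 1 \<and> vset v \<inter> vset w \<noteq> {}}"

definition edge_orientation ::
    "'v set set \<Rightarrow> ('v set \<Rightarrow> 'v) \<Rightarrow> ('v set \<Rightarrow> 'v) \<Rightarrow> bool" where
  "edge_orientation E src tgt \<longleftrightarrow> (\<forall>e\<in>E. e = {src e, tgt e})"

definition poisson_extension ::
    "'a::metric_space measure \<Rightarrow> ('a \<Rightarrow> real) \<Rightarrow> 'a vertex \<Rightarrow> real" where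
  "poisson_extension \<mu> f v = mean \<mu> (vset v) f"

definition differential ::
    "('v set \<Rightarrow> 'v) \<Rightarrow> ('v set \<Rightarrow> 'v) \<Rightarrow> ('v \<Rightarrow> real) \<Rightarrow> 'v set \<Rightarrow> real" where
  "differential src tgt u e = u (tgt e) - u (src e)"

text \<open>
  Elements are functions on the ambient type, of which only the values on \<open>M\<close> matter.
\<close>

definition weak_lp :: "real \<Rightarrow> 'm set \<Rightarrow> ('m \<Rightarrow> real) set" where
  "weak_lp p M = {s. \<exists>C\<ge>0. \<forall>t>0. finite {m\<in>M. \<bar>s m\<bar> > t} \<and>
     real (card {m\<in>M. \<bar>s m\<bar> > t}) \<le> (C / t) powr p}"

definition A_dot ::
    "'a::metric_space measure \<Rightarrow> (nat \<Rightarrow> 'a set) \<Rightarrow> ('a vertex set \<Rightarrow> 'a vertex) \<Rightarrow>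
     ('a vertex set \<Rightarrow> 'a vertex) \<Rightarrow> real \<Rightarrow> ('a \<Rightarrow> real) set" where
  "A_dot \<mu> N src tgt p =
     {f. integrable \<mu> f \<and>
         differential src tgt (poisson_extension \<mu> f) \<in> weak_lp p (edges N)}"

end

theory Submission
  imports Defs
begin

text \<open>
  Let \<open>f\<close> have Poisson extension with differential in weak \<open>\<ell>\<^sup>p\<close>, and write \<open>r = 2\<^sup>-\<^sup>n\<close>. Smoothing \<open>f\<close> at
  scale \<open>r\<close> means averaging it over the balls of radius \<open>2r\<close> about the net of level \<open>n\<close>, that is, taking
  the values of the Poisson extension on level \<open>n\<close>, and interpolating these averages by a Lipschitz
  partition of unity. The resulting function \<open>u\<^sub>n\<close> is used in the Poincare inequality on a ball that is
  all of \<open>Z\<close>.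

  Near a net point \<open>w\<close> the function \<open>u\<^sub>n\<close> has pointwise Lipschitz constant at most \<open>C/r\<close> times the sum of
  the differences \<open>|Pf(z) - Pf(w)|\<close> over the horizontal edges at \<open>w\<close>. A ball of radius \<open>r\<close> has measure
  about \<open>r\<^sup>Q\<close>, so the powers of \<open>r\<close> cancel: the integral of \<open>(Lip u\<^sub>n)\<^sup>Q\<close> is at most a constant times the
  sum of \<open>|d(Pf)|\<^sup>Q\<close> over the edges inside level \<open>n\<close> (\<open>integral_Lip_interp_le\<close>).

  Since \<open>p < Q\<close>, a weak \<open>\<ell>\<^sup>p\<close> sequence is in \<open>\<ell>\<^sup>Q\<close>, and its \<open>\<ell>\<^sup>Q\<close> sum over a set where it is at most \<open>T\<close>
  is \<open>O(T\<^sup>Q\<^sup>-\<^sup>p)\<close>. Only finitely many edges carry a value above \<open>T\<close>, so all deep levels avoid them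
  and the energies tend to \<open>0\<close> (\<open>energy_tendsto_0\<close>). The Poincare inequality with exponent \<open>Q\<close> then
  shows that \<open>u\<^sub>n\<close> minus its mean tends to \<open>0\<close> in \<open>L\<^sup>1\<close>.

  Finally \<open>u\<^sub>n\<close> tends to \<open>f\<close> in \<open>L\<^sup>1\<close> (\<open>net_smoothing_tendsto\<close>): the smoothing operators are uniformly bounded
  on \<open>L\<^sup>1\<close> by bounded overlap, move a Lipschitz function by \<open>O(r)\<close> uniformly, and Lipschitz functions are
  dense. Hence \<open>f\<close> equals its mean almost everywhere.
\<close>

section \<open>Sums of powers of weak Lebesgue sequences\<close>

text \<open>
  Halving the threshold \<open>T\<close>: the terms above \<open>T / 2\<close> number at most \<open>(2C / T)\<^sup>p\<close> and contribute at most
  \<open>(2C)\<^sup>p T\<^sup>q\<^sup>-\<^sup>p\<close>, and the bound for the other terms gains the factor \<open>2\<^sup>p\<^sup>-\<^sup>q < 1\<close>. The constant is the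
  sum of the resulting geometric series. The parameter \<open>k\<close> says after how many halvings
  only zero terms remain.
\<close>

lemma weak_lp_dyadic_sum_le:
  fixes s :: "'m \<Rightarrow> real"
  assumes p: "0 < p" "p < q" and C: "0 \<le> C"
    and count: "\<And>t. 0 < t \<Longrightarrow> real (card {m \<in> M. \<bar>s m\<bar> > t}) \<le> (C / t) powr p"
    and fin: "\<And>t. 0 < t \<Longrightarrow> finite {m \<in> M. \<bar>s m\<bar> > t}"
    and F: "finite F" "F \<subseteq> M" and T: "0 < T" and le: "\<And>m. m \<in> F \<Longrightarrow> \<bar>s m\<bar> \<le> T"
    and k: "\<And>m. m \<in> F \<Longrightarrow> s m = 0 \<or> T / 2 ^ k < \<bar>s m\<bar>"
  shows "(\<Sum>m\<in>F. \<bar>s m\<bar> powr q) \<le> (2 * C) powr p / (1 - 2 powr (p - q)) * T powr (q - p)"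
  using F T le k
proof (induction k arbitrary: F T)
  case 0
  have "(\<Sum>m\<in>F. \<bar>s m\<bar> powr q) = 0"
    using "0.prems"(4,5) by (intro sum.neutral) fastforce
  moreover have "2 powr (p - q) < 1"
    using p powr_less_mono[of "p - q" 0 2] by simp
  ultimately show ?case
    by simp
next
  case (Suc k)
  define K where "K = (2 * C) powr p / (1 - 2 powr (p - q))"
  let ?F1 = "{m \<in> F. \<bar>s m\<bar> > T / 2}" and ?F2 = "{m \<in> F. \<bar>s m\<bar> \<le> T / 2}"
  have lt1: "2 powr (p - q) < 1"
    using p powr_less_mono[of "p - q" 0 2] by simp
  have "(\<Sum>m\<in>?F1. \<bar>s m\<bar> powr q) \<le> (\<Sum>m\<in>?F1. T powr q)"
    using p Suc.prems by (intro sum_mono powr_mono2) auto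
  also have "\<dots> = real (card ?F1) * T powr q"
    by simp
  also have "\<dots> \<le> (C / (T / 2)) powr p * T powr q"
  proof (intro mult_right_mono)
    have "card ?F1 \<le> card {m \<in> M. \<bar>s m\<bar> > T / 2}"
      using Suc.prems by (intro card_mono fin) auto
    then show "real (card ?F1) \<le> (C / (T / 2)) powr p"
      using count[of "T / 2"] Suc.prems(3) by linarith
  qed simp
  also have "\<dots> = (2 * C) powr p * T powr (q - p)"
    using Suc.prems(3) C by (simp add: powr_divide powr_diff mult.commute)
  finally have 1: "(\<Sum>m\<in>?F1. \<bar>s m\<bar> powr q) \<le> (2 * C) powr p * T powr (q - p)" .
  have "(\<Sum>m\<in>?F2. \<bar>s m\<bar> powr q) \<le> K * (T / 2) powr (q - p)"
    unfolding K_def using Suc.prems by (intro Suc.IH) auto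
  also have "\<dots> = K * 2 powr (p - q) * T powr (q - p)"
    using Suc.prems(3) by (simp add: powr_divide powr_diff)
  finally have 2: "(\<Sum>m\<in>?F2. \<bar>s m\<bar> powr q) \<le> K * 2 powr (p - q) * T powr (q - p)" .
  have "(\<Sum>m\<in>F. \<bar>s m\<bar> powr q) = (\<Sum>m\<in>?F1. \<bar>s m\<bar> powr q) + (\<Sum>m\<in>?F2. \<bar>s m\<bar> powr q)"
    using Suc.prems(1) by (subst sum.union_disjoint[symmetric]) (auto intro!: sum.cong)
  also have "\<dots> \<le> ((2 * C) powr p + K * 2 powr (p - q)) * T powr (q - p)"
    using 1 2 by (simp add: algebra_simps)
  also have "(2 * C) powr p + K * 2 powr (p - q) = K"
  proof -
    have "1 - 2 powr (p - q) \<noteq> 0"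
      using p by simp
    then have "K * (1 - 2 powr (p - q)) = (2 * C) powr p"
      unfolding K_def by (rule nonzero_eq_divide_eq[THEN iffD1]) simp
    then show ?thesis
      by (simp add: right_diff_distrib)
  qed
  finally show ?case
    by (simp add: K_def)
qed

text \<open>
  For finite \<open>F\<close> some number of halvings always suffices. The positive power of \<open>T\<close> is what makes
  the energy of deep levels small.
\<close>

lemma weak_lp_sum_le:
  fixes s :: "'m \<Rightarrow> real"
  assumes p: "0 < p" "p < q" and C: "0 \<le> C"
    and count: "\<And>t. 0 < t \<Longrightarrow> real (card {m \<in> M. \<bar>s m\<bar> > t}) \<le> (C / t) powr p"
    and fin: "\<And>t. 0 < t \<Longrightarrow> finite {m \<in> M. \<bar>s m\<bar> > t}"
    and F: "finite F" "F \<subseteq> M" and T: "0 < T" and le: "\<And>m. m \<in> F \<Longrightarrow> \<bar>s m\<bar> \<le> T"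
  shows "(\<Sum>m\<in>F. \<bar>s m\<bar> powr q) \<le> (2 * C) powr p / (1 - 2 powr (p - q)) * T powr (q - p)"
proof -
  have "\<forall>m\<in>F. \<forall>\<^sub>F k in sequentially. s m = 0 \<or> T / 2 ^ k < \<bar>s m\<bar>"
  proof
    fix m
    have "(\<lambda>k. T / 2 ^ k) \<longlonglongrightarrow> 0"
      by (rule LIMSEQ_divide_realpow_zero) simp
    then show "\<forall>\<^sub>F k in sequentially. s m = 0 \<or> T / 2 ^ k < \<bar>s m\<bar>"
      by (cases "s m = 0") (auto dest: order_tendstoD(2)[where a = "\<bar>s m\<bar>"])
  qed
  then have "\<forall>\<^sub>F k in sequentially. \<forall>m\<in>F. s m = 0 \<or> T / 2 ^ k < \<bar>s m\<bar>"
    using F(1) by (simp add: eventually_ball_finite)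
  then obtain k where "\<forall>m\<in>F. s m = 0 \<or> T / 2 ^ k < \<bar>s m\<bar>"
    by (auto simp: eventually_sequentially)
  then show ?thesis
    using assms by (intro weak_lp_dyadic_sum_le[where M = M and k = k]) auto
qed

section \<open>Density of Lipschitz functions in the integrable functions\<close>

definition lipschitz_approximable :: "'a::metric_space measure \<Rightarrow> ('a \<Rightarrow> real) \<Rightarrow> bool" where
  "lipschitz_approximable M f \<longleftrightarrow>
     (\<forall>e>0. \<exists>g L. L-lipschitz_on UNIV g \<and> integrable M g \<and> (\<integral>x. \<bar>f x - g x\<bar> \<partial>M) < e)"

lemma lipschitz_approximable_lipschitz:
  "L-lipschitz_on UNIV g \<Longrightarrow> integrable M g \<Longrightarrow> lipschitz_approximable M g"
  by (force simp: lipschitz_approximable_def)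

lemma lipschitz_approximable_add:
  assumes f: "integrable M f" "lipschitz_approximable M f"
    and g: "integrable M g" "lipschitz_approximable M g"
  shows "lipschitz_approximable M (\<lambda>x. f x + g x)"
  unfolding lipschitz_approximable_def
proof (intro allI impI)
  fix e :: real assume "0 < e"
  then have e: "0 < e / 2" by simp
  obtain f' K where f': "K-lipschitz_on UNIV f'" "integrable M f'" "(\<integral>x. \<bar>f x - f' x\<bar> \<partial>M) < e / 2"
    using f(2) e unfolding lipschitz_approximable_def by meson
  obtain g' L where g': "L-lipschitz_on UNIV g'" "integrable M g'" "(\<integral>x. \<bar>g x - g' x\<bar> \<partial>M) < e / 2"
    using g(2) e unfolding lipschitz_approximable_def by meson
  have "(\<integral>x. \<bar>f x + g x - (f' x + g' x)\<bar> \<partial>M) \<le> (\<integral>x. \<bar>f x - f' x\<bar> + \<bar>g x - g' x\<bar> \<partial>M)"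
    using f g f' g' by (intro integral_mono) auto
  also have "\<dots> = (\<integral>x. \<bar>f x - f' x\<bar> \<partial>M) + (\<integral>x. \<bar>g x - g' x\<bar> \<partial>M)"
    using f g f' g' by (intro Bochner_Integration.integral_add) auto
  also have "\<dots> < e"
    using f' g' by simp
  finally show "\<exists>h L. L-lipschitz_on UNIV h \<and> integrable M h \<and> (\<integral>x. \<bar>f x + g x - h x\<bar> \<partial>M) < e"
    using f' g' lipschitz_on_add[OF f'(1) g'(1)]
    by (intro exI[of _ "\<lambda>x. f' x + g' x"] exI[of _ "K + L"]) auto
qed

lemma lipschitz_approximable_scale:
  assumes f: "lipschitz_approximable M f"
  shows "lipschitz_approximable M (\<lambda>x. c * f x)"
  unfolding lipschitz_approximable_def
proof (intro allI impI)
  fix e :: real assume e: "0 < e"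
  then have "0 < e / (\<bar>c\<bar> + 1)" by (simp add: add_nonneg_pos)
  then obtain g L where g: "L-lipschitz_on UNIV g" "integrable M g"
      "(\<integral>x. \<bar>f x - g x\<bar> \<partial>M) < e / (\<bar>c\<bar> + 1)"
    using f unfolding lipschitz_approximable_def by meson
  have "(\<integral>x. \<bar>c * f x - c * g x\<bar> \<partial>M) = \<bar>c\<bar> * (\<integral>x. \<bar>f x - g x\<bar> \<partial>M)"
    by (simp add: right_diff_distrib[symmetric] abs_mult)
  also have "\<dots> \<le> \<bar>c\<bar> * (e / (\<bar>c\<bar> + 1))"
    using g by (intro mult_left_mono) auto
  also have "\<dots> < e"
    using e by (simp add: field_simps)
  finally show "\<exists>h L. L-lipschitz_on UNIV h \<and> integrable M h \<and> (\<integral>x. \<bar>c * f x - h x\<bar> \<partial>M) < e"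
    using g lipschitz_on_cmult_real[OF g(1), of c]
    by (intro exI[of _ "\<lambda>x. c * g x"] exI[of _ "\<bar>c\<bar> * L"]) auto
qed

lemma lipschitz_approximable_limit:
  assumes f: "integrable M f"
    and s: "\<And>i. integrable M (s i)" "\<And>i::nat. lipschitz_approximable M (s i)"
    and lim: "\<And>x. x \<in> space M \<Longrightarrow> (\<lambda>i. s i x) \<longlonglongrightarrow> f x"
    and w: "integrable M w" "\<And>i x. x \<in> space M \<Longrightarrow> \<bar>s i x\<bar> \<le> w x"
  shows "lipschitz_approximable M f"
  unfolding lipschitz_approximable_def
proof (intro allI impI)
  fix e :: real assume "0 < e"
  then have e: "0 < e / 2" by simp
  have "(\<lambda>i. \<integral>x. \<bar>f x - s i x\<bar> \<partial>M) \<longlonglongrightarrow> (\<integral>x. 0 \<partial>M)"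
  proof (rule integral_dominated_convergence)
    show "integrable M (\<lambda>x. \<bar>f x\<bar> + w x)"
      using f w by auto
    show "AE x in M. (\<lambda>i. \<bar>f x - s i x\<bar>) \<longlonglongrightarrow> 0"
    proof (rule AE_I2)
      fix x assume "x \<in> space M"
      then have "(\<lambda>i. \<bar>f x - s i x\<bar>) \<longlonglongrightarrow> \<bar>f x - f x\<bar>"
        by (intro tendsto_intros lim)
      then show "(\<lambda>i. \<bar>f x - s i x\<bar>) \<longlonglongrightarrow> 0" by simp
    qed
    show "AE x in M. norm \<bar>f x - s i x\<bar> \<le> \<bar>f x\<bar> + w x" for i
    proof (rule AE_I2)
      fix x assume "x \<in> space M"
      then show "norm \<bar>f x - s i x\<bar> \<le> \<bar>f x\<bar> + w x"
        using w(2)[of x i] by simp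
    qed
  qed (use f s in auto)
  then have "\<forall>\<^sub>F i in sequentially. (\<integral>x. \<bar>f x - s i x\<bar> \<partial>M) < e / 2"
    using e by (intro order_tendstoD(2)[where y = "\<integral>x. 0 \<partial>M"]) auto
  then obtain i where i: "(\<integral>x. \<bar>f x - s i x\<bar> \<partial>M) < e / 2"
    by (auto simp: eventually_sequentially)
  obtain g L where g: "L-lipschitz_on UNIV g" "integrable M g" "(\<integral>x. \<bar>s i x - g x\<bar> \<partial>M) < e / 2"
    using s(2)[of i] e unfolding lipschitz_approximable_def by meson
  have "(\<integral>x. \<bar>f x - g x\<bar> \<partial>M) \<le> (\<integral>x. \<bar>f x - s i x\<bar> + \<bar>s i x - g x\<bar> \<partial>M)"
    using f s(1)[of i] g by (intro integral_mono) auto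
  also have "\<dots> = (\<integral>x. \<bar>f x - s i x\<bar> \<partial>M) + (\<integral>x. \<bar>s i x - g x\<bar> \<partial>M)"
    using f s(1)[of i] g by (intro Bochner_Integration.integral_add) auto
  also have "\<dots> < e"
    using g i by simp
  finally show "\<exists>g L. L-lipschitz_on UNIV g \<and> integrable M g \<and> (\<integral>x. \<bar>f x - g x\<bar> \<partial>M) < e"
    using g by auto
qed

text \<open>
  The indicator of \<open>F\<close> is the limit of the functions \<open>max 0 (1 - i d(x, F))\<close>. They work only for
  nonempty \<open>F\<close> because \<^const>\<open>infdist\<close> to the empty set is \<open>0\<close>.
\<close>

lemma lipschitz_approximable_indicator_closed:
  fixes M :: "'a::metric_space measure"
  assumes M: "finite_measure M" "sets M = sets borel" and F: "closed F" "F \<noteq> {}"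
  shows "lipschitz_approximable M (indicator F)"
proof -
  interpret finite_measure M by fact
  define s where "s = (\<lambda>i x. max 0 (1 - real i * infdist x F))"
  have lips: "(real i)-lipschitz_on UNIV (s i)" for i
  proof (rule lipschitz_onI)
    fix x y
    have "real i * \<bar>infdist x F - infdist y F\<bar> \<le> real i * dist x y"
      by (intro mult_left_mono infdist_triangle_abs) simp
    then have "\<bar>real i * infdist x F - real i * infdist y F\<bar> \<le> real i * dist x y"
      by (simp add: right_diff_distrib[symmetric] abs_mult)
    then show "dist (s i x) (s i y) \<le> real i * dist x y"
      unfolding s_def dist_real_def by linarith
  qed simp
  have bound: "\<bar>s i x\<bar> \<le> 1" for i x
    using infdist_nonneg[of x F] by (simp add: s_def)
  have int: "integrable M (s i)" for i
  proof (rule integrable_const_bound)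
    have "s i \<in> borel_measurable borel"
      using lipschitz_on_continuous_on[OF lips] by (rule borel_measurable_continuous_onI)
    then show "s i \<in> borel_measurable M"
      using measurable_cong_sets[OF M(2) refl] by blast
  qed (use bound in auto)
  show ?thesis
  proof (rule lipschitz_approximable_limit[where s = s and w = "\<lambda>_. 1"])
    show "integrable M (indicator F :: 'a \<Rightarrow> real)"
      using M(2) F(1) by (intro integrable_real_indicator) (auto simp: less_top[symmetric])
    show "lipschitz_approximable M (s i)" for i
      by (rule lipschitz_approximable_lipschitz[OF lips int])
    show "(\<lambda>i. s i x) \<longlonglongrightarrow> indicator F x" for x
    proof (cases "x \<in> F")
      case True
      then show ?thesis by (simp add: s_def)
    next
      case False
      then have pos: "0 < infdist x F"
        using F infdist_pos_not_in_closed by blast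
      obtain k :: nat where k: "1 / infdist x F < real k"
        using reals_Archimedean2 by blast
      have "s i x = 0" if "k \<le> i" for i
      proof -
        have "1 / infdist x F < real i"
          using k that by simp
        then show ?thesis
          using pos by (simp add: s_def field_simps)
      qed
      then show ?thesis
        using False by (auto intro!: tendsto_eventually eventually_sequentiallyI[of k])
    qed
  qed (use int bound in auto)
qed

text \<open>
  The sets with approximable indicator form a Dynkin system, and the closed sets are an
  intersection-stable generator of the Borel sets.
\<close>

lemma lipschitz_approximable_indicator:
  fixes M :: "'a::metric_space measure"
  assumes M: "finite_measure M" "sets M = sets borel" and A: "A \<in> sets M"
  shows "lipschitz_approximable M (indicator A)"
proof -
  interpret finite_measure M by fact
  have zero: "lipschitz_approximable M (\<lambda>_. 0)" and one: "lipschitz_approximable M (\<lambda>_. 1)"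
    by (rule lipschitz_approximable_lipschitz[where L = 0]; simp add: lipschitz_on_def)+
  have ind: "integrable M (indicator B :: 'a \<Rightarrow> real)" if "B \<in> sets M" for B
    using that by (intro integrable_real_indicator) (auto simp: less_top[symmetric])
  have sets_M: "sets M = sigma_sets UNIV (Collect closed)"
    unfolding M(2) borel_eq_closed by (simp add: sets_measure_of)
  have "Int_stable (Collect closed :: 'a set set)" "(Collect closed :: 'a set set) \<subseteq> Pow UNIV"
    and "A \<in> sigma_sets UNIV (Collect closed)"
    using A sets_M by (auto simp: Int_stable_def)
  then show ?thesis
  proof (induction rule: sigma_sets_induct_disjoint)
    case (basic F)
    show ?case
    proof (cases "F = {}")
      case True
      then show ?thesis using zero by (simp add: indicator_def)
    next
      case False
      then show ?thesis
        using basic by (intro lipschitz_approximable_indicator_closed M) auto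
    qed
  next
    case empty
    show ?case using zero by (simp add: indicator_def)
  next
    case (compl B)
    then have B: "B \<in> sets M" using sets_M by simp
    have "lipschitz_approximable M (\<lambda>x. 1 + (-1) * indicator B x)"
      using compl ind[OF B] one
      by (intro lipschitz_approximable_add lipschitz_approximable_scale) auto
    also have "(\<lambda>x. 1 + (-1) * indicator B x) = (indicator (UNIV - B) :: 'a \<Rightarrow> real)"
      by (auto simp: indicator_def)
    finally show ?case .
  next
    case (union B)
    then have B: "B i \<in> sets M" for i using sets_M by auto
    have sums: "(\<lambda>i. indicator (B i) x :: real) sums indicator (\<Union>i. B i) x" for x
      using union(1) by (intro indicator_sums) (auto simp: disjoint_family_on_def)
    have partial: "integrable M (\<lambda>x. \<Sum>i<n. indicator (B i) x :: real) \<and>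
        lipschitz_approximable M (\<lambda>x. \<Sum>i<n. indicator (B i) x)" for n
      using zero union(3) ind[OF B] by (induction n) (auto intro!: lipschitz_approximable_add)
    show ?case
    proof (rule lipschitz_approximable_limit
        [where s = "\<lambda>n x. \<Sum>i<n. indicator (B i) x" and w = "\<lambda>_. 1"])
      show "\<bar>\<Sum>i<n. indicator (B i) x :: real\<bar> \<le> 1" for n x
      proof -
        have "(\<Sum>i<n. indicator (B i) x :: real) \<le> (\<Sum>i. indicator (B i) x)"
          using sums[of x] by (intro sum_le_suminf) (auto simp: sums_iff)
        also have "\<dots> \<le> 1"
          using sums[of x] by (simp add: sums_iff indicator_def)
        finally show ?thesis by (simp add: sum_nonneg)
      qed
    qed (use partial ind B sums in \<open>auto simp: sums_def\<close>)
  qed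
qed

lemma integrable_imp_lipschitz_approximable:
  fixes M :: "'a::metric_space measure"
  assumes M: "finite_measure M" "sets M = sets borel" and f: "integrable M f"
  shows "lipschitz_approximable M f"
  using f
proof (induction rule: integrable_induct)
  case (base A c)
  then show ?case
    using lipschitz_approximable_scale[OF lipschitz_approximable_indicator[OF M base(1)], of c]
    by (simp add: mult.commute)
next
  case (add f g)
  then show ?case by (intro lipschitz_approximable_add)
next
  case (lim f s)
  then show ?case
    by (intro lipschitz_approximable_limit[of M f s "\<lambda>x. 2 * \<bar>f x\<bar>"]) auto
qed

section \<open>Interpolation from a net by a partition of unity\<close>

text \<open>
  The lower bound matters because \<^const>\<open>Lip\<close> will be raised to a real power, which is monotone
  only on nonnegative arguments.
\<close>

lemma Lip_bounds:
  fixes f :: "'a::metric_space \<Rightarrow> real"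
  assumes d: "0 < d" and f: "\<And>y. dist x y < d \<Longrightarrow> \<bar>f y - f x\<bar> \<le> K * dist x y" and K: "0 \<le> K"
  shows "0 \<le> Lip f x" "Lip f x \<le> K"
proof -
  let ?S = "\<lambda>r. SUP y\<in>ball x r. ereal (\<bar>f y - f x\<bar> / r)"
  have small: "\<forall>\<^sub>F r in at_right (0::real). 0 < r \<and> r < d"
    using d eventually_at_right[of 0] by (auto intro!: exI[of _ d])
  have "Limsup (at_right 0) ?S \<le> ereal K"
  proof (rule Limsup_bounded, rule eventually_mono[OF small])
    fix r :: real assume r: "0 < r \<and> r < d"
    show "?S r \<le> ereal K"
    proof (rule SUP_least)
      fix y assume y: "y \<in> ball x r"
      then have "\<bar>f y - f x\<bar> \<le> K * dist x y"
        using r by (intro f) auto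
      also have "\<dots> \<le> K * r"
        using y K by (intro mult_left_mono) auto
      finally show "ereal (\<bar>f y - f x\<bar> / r) \<le> ereal K"
        using r by (simp add: field_simps)
    qed
  qed
  moreover have "0 \<le> Limsup (at_right 0) ?S"
  proof (rule le_Limsup, simp, rule eventually_mono[OF small])
    fix r :: real assume r: "0 < r \<and> r < d"
    show "0 \<le> ?S r"
      using r by (intro SUP_upper2[of x]) auto
  qed
  ultimately show "0 \<le> Lip f x" "Lip f x \<le> K"
    unfolding Lip_def by (auto simp: real_of_ereal_pos intro: real_le_ereal_iff[THEN iffD2])
qed

text \<open>
  The tent has height \<open>2\<close>, so that it vanishes outside the ball of radius \<open>2r\<close> and is at least \<open>1\<close> on the
  ball of radius \<open>r\<close>. On a net that comes within \<open>r\<close> of every point the denominator of the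
  interpolation is therefore at least \<open>1\<close>.
\<close>

definition tent :: "real \<Rightarrow> 'a::metric_space \<Rightarrow> 'a \<Rightarrow> real" where
  "tent r z x = max 0 (2 - dist x z / r)"

definition interp :: "real \<Rightarrow> 'a::metric_space set \<Rightarrow> ('a \<Rightarrow> real) \<Rightarrow> 'a \<Rightarrow> real" where
  "interp r A a x = (\<Sum>z\<in>A. a z * tent r z x) / (\<Sum>z\<in>A. tent r z x)"

lemma tent_nonneg: "0 \<le> tent r z x"
  by (simp add: tent_def)

lemma tent_eq_0: "0 < r \<Longrightarrow> 2 * r \<le> dist x z \<Longrightarrow> tent r z x = 0"
  by (simp add: tent_def field_simps)

lemma tent_ge_1: "0 < r \<Longrightarrow> dist x z < r \<Longrightarrow> 1 \<le> tent r z x"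
  by (simp add: tent_def field_simps)

lemma tent_diff_le:
  assumes "0 < r"
  shows "\<bar>tent r z y - tent r z x\<bar> \<le> dist x y / r"
proof -
  have "\<bar>dist y z / r - dist x z / r\<bar> \<le> dist x y / r"
    using assms abs_dist_diff_le[of y z x]
    by (simp add: diff_divide_distrib[symmetric] dist_commute divide_right_mono)
  then show ?thesis
    unfolding tent_def by linarith
qed

lemma sum_tent_ge_1:
  assumes "finite A" "0 < r" "\<exists>z\<in>A. dist x z < r"
  shows "1 \<le> (\<Sum>z\<in>A. tent r z x)"
proof -
  obtain z where z: "z \<in> A" "dist x z < r"
    using assms(3) by blast
  have "1 \<le> tent r z x"
    using assms(2) z by (simp add: tent_ge_1)
  also have "\<dots> \<le> (\<Sum>z\<in>A. tent r z x)"
    using assms(1) z by (intro member_le_sum tent_nonneg)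
  finally show ?thesis .
qed

lemma interp_diff_const:
  assumes "finite A" "W \<subseteq> A" "0 < (\<Sum>z\<in>A. tent r z x)"
    and "\<And>z. z \<in> A - W \<Longrightarrow> tent r z x = 0"
  shows "interp r A a x - b = (\<Sum>z\<in>W. (a z - b) * (tent r z x / (\<Sum>z\<in>W. tent r z x)))"
    and "(\<Sum>z\<in>W. tent r z x) = (\<Sum>z\<in>A. tent r z x)"
proof -
  have 1: "(\<Sum>z\<in>W. tent r z x) = (\<Sum>z\<in>A. tent r z x)"
    using assms by (intro sum.mono_neutral_left) auto
  have 2: "(\<Sum>z\<in>W. a z * tent r z x) = (\<Sum>z\<in>A. a z * tent r z x)"
    using assms by (intro sum.mono_neutral_left) auto
  have "(\<Sum>z\<in>W. (a z - b) * tent r z x) = (\<Sum>z\<in>A. a z * tent r z x) - b * (\<Sum>z\<in>A. tent r z x)"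
    by (simp add: left_diff_distrib sum_subtractf sum_distrib_left[symmetric] 1 2)
  moreover have "(\<Sum>z\<in>W. (a z - b) * (tent r z x / (\<Sum>z\<in>W. tent r z x)))
      = (\<Sum>z\<in>W. (a z - b) * tent r z x) / (\<Sum>z\<in>A. tent r z x)"
    by (simp add: 1 sum_divide_distrib)
  ultimately show "interp r A a x - b = (\<Sum>z\<in>W. (a z - b) * (tent r z x / (\<Sum>z\<in>W. tent r z x)))"
    using assms(3) by (simp add: interp_def diff_divide_distrib)
  show "(\<Sum>z\<in>W. tent r z x) = (\<Sum>z\<in>A. tent r z x)"
    by fact
qed

text \<open>
  The weights sum to \<open>1\<close>, so any constant \<open>b\<close> may be subtracted from the values; each normalised weight
  is Lipschitz with constant \<open>(1 + card W) / r\<close>, one unit for its numerator and \<open>card W\<close> for the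
  denominator. Choosing \<open>W\<close> to be the whole net gives a global Lipschitz constant, choosing
  the net points near \<open>x\<close> gives one that is uniform in the scale.
\<close>

lemma interp_diff_le:
  assumes A: "finite A" "W \<subseteq> A" and r: "0 < r"
    and x: "\<exists>z\<in>A. dist x z < r" "\<And>z. z \<in> A - W \<Longrightarrow> tent r z x = 0"
    and y: "\<exists>z\<in>A. dist y z < r" "\<And>z. z \<in> A - W \<Longrightarrow> tent r z y = 0"
  shows "\<bar>interp r A a y - interp r A a x\<bar>
    \<le> (1 + real (card W)) / r * (\<Sum>z\<in>W. \<bar>a z - b\<bar>) * dist x y"
proof -
  define S where "S = (\<lambda>x. \<Sum>z\<in>W. tent r z x)"
  have Sx: "1 \<le> S x" and Sy: "1 \<le> S y"
    using sum_tent_ge_1[OF A(1) r x(1)] sum_tent_ge_1[OF A(1) r y(1)]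
      interp_diff_const(2)[OF A _ x(2)] interp_diff_const(2)[OF A _ y(2)]
    by (auto simp: S_def)
  have fW: "finite W"
    using A finite_subset by blast
  have S_diff: "\<bar>S x - S y\<bar> \<le> real (card W) * (dist x y / r)"
  proof -
    have "\<bar>S x - S y\<bar> \<le> (\<Sum>z\<in>W. \<bar>tent r z x - tent r z y\<bar>)"
      unfolding S_def sum_subtractf[symmetric] by (rule sum_abs)
    also have "\<dots> \<le> (\<Sum>z\<in>W. dist x y / r)"
      using tent_diff_le[OF r] by (intro sum_mono) (simp add: dist_commute)
    finally show ?thesis by simp
  qed
  have weight: "\<bar>tent r z y / S y - tent r z x / S x\<bar> \<le> (1 + real (card W)) / r * dist x y"
    if z: "z \<in> W" for z
  proof -
    have "tent r z x \<le> S x"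
      unfolding S_def using z fW by (intro member_le_sum tent_nonneg)
    then have le1: "tent r z x / S x \<le> 1"
      using Sx by simp
    have "tent r z y / S y - tent r z x / S x
        = (tent r z y - tent r z x) / S y + tent r z x / S x * ((S x - S y) / S y)"
      using Sx Sy by (simp add: field_simps)
    also have "\<bar>\<dots>\<bar> \<le> \<bar>tent r z y - tent r z x\<bar> / S y + tent r z x / S x * (\<bar>S x - S y\<bar> / S y)"
      using Sx Sy tent_nonneg[of r z x] by (intro order_trans[OF abs_triangle_ineq]) (simp add: abs_mult)
    also have "\<dots> \<le> dist x y / r + 1 * (real (card W) * (dist x y / r))"
    proof (intro add_mono mult_mono le1)
      show "\<bar>tent r z y - tent r z x\<bar> / S y \<le> dist x y / r"
        using Sy tent_diff_le[OF r, of z y x] by (smt (verit) divide_le_eq_1 div_by_1 frac_le abs_ge_zero)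
      show "\<bar>S x - S y\<bar> / S y \<le> real (card W) * (dist x y / r)"
        using Sy S_diff by (smt (verit) div_by_1 frac_le abs_ge_zero)
    qed (use Sx Sy in auto)
    finally show ?thesis
      by (simp add: field_simps add_divide_distrib)
  qed
  have ix: "interp r A a x - b = (\<Sum>z\<in>W. (a z - b) * (tent r z x / S x))"
    unfolding S_def using sum_tent_ge_1[OF A(1) r x(1)] by (intro interp_diff_const(1) A x(2)) auto
  have iy: "interp r A a y - b = (\<Sum>z\<in>W. (a z - b) * (tent r z y / S y))"
    unfolding S_def using sum_tent_ge_1[OF A(1) r y(1)] by (intro interp_diff_const(1) A y(2)) auto
  have "interp r A a y - interp r A a x = (interp r A a y - b) - (interp r A a x - b)"
    by simp
  also have "\<dots> = (\<Sum>z\<in>W. (a z - b) * (tent r z y / S y)) - (\<Sum>z\<in>W. (a z - b) * (tent r z x / S x))"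
    by (simp only: ix iy)
  also have "\<dots> = (\<Sum>z\<in>W. (a z - b) * (tent r z y / S y - tent r z x / S x))"
    by (simp add: right_diff_distrib sum_subtractf)
  also have "\<bar>\<dots>\<bar> \<le> (\<Sum>z\<in>W. \<bar>a z - b\<bar> * ((1 + real (card W)) / r * dist x y))"
    by (rule order_trans[OF sum_abs])
      (unfold abs_mult, intro sum_mono mult_left_mono weight abs_ge_zero)
  also have "\<dots> = (1 + real (card W)) / r * (\<Sum>z\<in>W. \<bar>a z - b\<bar>) * dist x y"
    by (simp only: sum_distrib_right[symmetric] sum_distrib_left[symmetric]) (simp add: mult_ac)
  finally show ?thesis .
qed

section \<open>Nets in compact spaces\<close>

lemma maximal_separated_covers:
  assumes "maximal_separated r A"  "0 < r"
  shows "\<exists>z\<in>A. dist x z < r"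
proof (rule ccontr)
  assume no: "\<not> (\<exists>z\<in>A. dist x z < r)"
  then have "separated r (insert x A)"
    using assms by (auto simp: maximal_separated_def separated_def dist_commute not_less)
  then have "insert x A = A"
    using assms(1) unfolding maximal_separated_def by blast
  then show False
    using no assms(2) by force
qed

lemma separated_finite:
  assumes "compact (UNIV :: 'a::metric_space set)" "separated r (A :: 'a set)" "0 < r"
  shows "finite A"
proof -
  have "\<exists>k. finite k \<and> k \<subseteq> (UNIV::'a set) \<and> UNIV \<subseteq> (\<Union>x\<in>k. ball x (r / 2))"
    using assms(1,3) compact_eq_totally_bounded[of "UNIV :: 'a set"] by auto
  then obtain k where k: "finite k" "\<And>x::'a. \<exists>c\<in>k. dist c x < r / 2"
    by force
  obtain g where g: "\<And>x. g x \<in> k" "\<And>x. dist (g x) x < r / 2"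
    using k(2) by metis
  have "inj_on g A"
  proof (rule inj_onI)
    fix x y assume xy: "x \<in> A" "y \<in> A" "g x = g y"
    have "dist x y < r"
      using dist_triangle_half_r[of "g x" x r y] g(2)[of x] g(2)[of y] xy(3) by simp
    then show "x = y"
      using assms(2) xy unfolding separated_def by force
  qed
  moreover have "finite (g ` A)"
    using k(1) g(1) finite_subset[of "g ` A" k] by blast
  ultimately show ?thesis
    using finite_image_iff by blast
qed

section \<open>Smoothing at the scale of a net\<close>

text \<open>
  The sum is at most \<open>K\<close> times its largest term.
\<close>

lemma sum_powr_le:
  fixes g :: "'b \<Rightarrow> real"
  assumes W: "finite W" "real (card W) \<le> K" and g: "\<And>z. z \<in> W \<Longrightarrow> 0 \<le> g z" and q: "0 < q"
  shows "(\<Sum>z\<in>W. g z) powr q \<le> K powr q * (\<Sum>z\<in>W. g z powr q)"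
proof (cases "W = {}")
  case True
  then show ?thesis by simp
next
  case False
  have "Max (g ` W) \<in> g ` W"
    using W(1) False by (intro Max_in) auto
  then obtain w where w: "w \<in> W" "g w = Max (g ` W)"
    by (metis imageE)
  have le: "g z \<le> g w" if "z \<in> W" for z
    using that W(1) by (simp add: w(2))
  have "(\<Sum>z\<in>W. g z) \<le> (\<Sum>z\<in>W. g w)"
    by (intro sum_mono le)
  also have "\<dots> \<le> K * g w"
    using W(2) g[OF w(1)] by (simp add: mult_right_mono)
  finally have "(\<Sum>z\<in>W. g z) powr q \<le> (K * g w) powr q"
    using g q by (intro powr_mono2) (auto intro: sum_nonneg)
  also have "\<dots> = K powr q * g w powr q"
    by (rule powr_mult)
  also have "\<dots> \<le> K powr q * (\<Sum>z\<in>W. g z powr q)"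
    using w(1) W(1) by (intro mult_left_mono member_le_sum) auto
  finally show ?thesis .
qed

text \<open>
  When \<open>A\<close> is the net of level \<open>n \<ge> 1\<close> and \<open>r = 2\<^sup>-\<^sup>n\<close>, these are the other ends of the horizontal edges of
  the hyperbolic filling at the vertex with centre \<open>w\<close>, together with \<open>w\<close> itself.
\<close>

definition nbrs :: "real \<Rightarrow> 'a::metric_space set \<Rightarrow> 'a \<Rightarrow> 'a set" where
  "nbrs r A w = {z \<in> A. ball w (2 * r) \<inter> ball z (2 * r) \<noteq> {}}"

definition net_smoothing ::
    "'a::metric_space measure \<Rightarrow> real \<Rightarrow> 'a set \<Rightarrow> ('a \<Rightarrow> real) \<Rightarrow> 'a \<Rightarrow> real" where
  "net_smoothing \<mu> r A f = interp r A (\<lambda>z. mean \<mu> (ball z (2 * r)) f)"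

text \<open>
  Ahlfors regularity with its constant fixed and stated with real-valued measures.
\<close>

locale regular_space = finite_measure \<mu>
  for \<mu> :: "'a::metric_space measure" +
  fixes Q c :: real
  assumes sets_\<mu>: "sets \<mu> = sets borel"
    and Q_pos: "0 < Q"
    and c_ge_1: "1 \<le> c"
    and ball_lower: "0 < \<rho> \<Longrightarrow> \<rho> \<le> 1 \<Longrightarrow> inverse c * \<rho> powr Q \<le> measure \<mu> (ball z \<rho>)"
    and ball_upper: "0 < \<rho> \<Longrightarrow> \<rho> \<le> 1 \<Longrightarrow> measure \<mu> (ball z \<rho>) \<le> c * \<rho> powr Q"
begin

lemma space_\<mu>: "space \<mu> = UNIV"
  using sets_eq_imp_space_eq[OF sets_\<mu>] by simp

lemma ball_sets [measurable]: "ball z \<rho> \<in> sets \<mu>"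
  by (simp add: sets_\<mu>)

lemma integrable_ball [simp]: "integrable \<mu> (indicator (ball z \<rho>) :: 'a \<Rightarrow> real)"
  by (intro integrable_real_indicator) (auto simp: less_top[symmetric])

lemma continuous_measurable: "continuous_on UNIV g \<Longrightarrow> g \<in> borel_measurable \<mu>" for g :: "'a \<Rightarrow> real"
  using borel_measurable_continuous_onI measurable_cong_sets[OF sets_\<mu> refl] by blast

text \<open>
  Bounds the number of net points in a ball of radius \<open>4r\<close>, whatever the scale \<open>r\<close>.
\<close>

definition overlap :: real where
  "overlap = c\<^sup>2 * 10 powr Q"

lemma overlap_nonneg: "0 \<le> overlap"
  by (simp add: overlap_def)

end

text \<open>
  The bound \<open>5 r \<le> 1\<close> keeps all balls that occur below within the range of radii for which Ahlfors
  regularity is assumed; for the nets of a filling it holds from level \<open>3\<close> on.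
\<close>

locale fine_net = regular_space \<mu> Q c
  for \<mu> :: "'a::metric_space measure" and Q c :: real +
  fixes r :: real and A :: "'a set"
  assumes finite_A: "finite A"
    and separated_A: "separated r A"
    and covers: "\<exists>z\<in>A. dist x z < r"
    and r_pos: "0 < r"
    and r_small: "5 * r \<le> 1"
begin

text \<open>
  Volume comparison: the balls of radius \<open>r / 2\<close> about the net points are disjoint, and those that count
  lie in the ball of radius \<open>5 r\<close> about \<open>x\<close>. The ratio of the radii is \<open>10\<close>.
\<close>

lemma card_near_le: "real (card {z \<in> A. dist x z < 4 * r}) \<le> overlap"
proof -
  let ?W = "{z \<in> A. dist x z < 4 * r}"
  have disj: "disjoint_family_on (\<lambda>z. ball z (r / 2)) ?W"
    unfolding disjoint_family_on_def
  proof (intro ballI impI)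
    fix z w assume zw: "z \<in> ?W" "w \<in> ?W" "z \<noteq> w"
    show "ball z (r / 2) \<inter> ball w (r / 2) = {}"
    proof (rule ccontr)
      assume "ball z (r / 2) \<inter> ball w (r / 2) \<noteq> {}"
      then obtain y where "dist z y < r / 2" "dist w y < r / 2" by auto
      then have "dist z w < r"
        by (metis dist_commute dist_triangle_half_r)
      then show False
        using separated_A zw unfolding separated_def by force
    qed
  qed
  have "real (card ?W) * (inverse c * (r / 2) powr Q) = (\<Sum>z\<in>?W. inverse c * (r / 2) powr Q)"
    by simp
  also have "\<dots> \<le> (\<Sum>z\<in>?W. measure \<mu> (ball z (r / 2)))"
    using r_pos r_small by (intro sum_mono ball_lower) auto
  also have "\<dots> = measure \<mu> (\<Union>z\<in>?W. ball z (r / 2))"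
    using finite_A disj by (intro finite_measure_finite_Union[symmetric]) auto
  also have "\<dots> \<le> measure \<mu> (ball x (5 * r))"
  proof (intro finite_measure_mono)
    show "(\<Union>z\<in>?W. ball z (r / 2)) \<subseteq> ball x (5 * r)"
    proof
      fix y assume "y \<in> (\<Union>z\<in>?W. ball z (r / 2))"
      then obtain z where "dist x z < 4 * r" "dist z y < r / 2" by auto
      then have "dist x y < 4 * r + r / 2"
        using dist_triangle[of x y z] by linarith
      then show "y \<in> ball x (5 * r)"
        using r_pos by simp
    qed
  qed simp
  also have "\<dots> \<le> c * (5 * r) powr Q"
    using r_pos r_small by (intro ball_upper) auto
  also have "(5 * r) powr Q = 10 powr Q * (r / 2) powr Q"
    using r_pos by (subst powr_mult[symmetric]) auto
  finally have "real (card ?W) * inverse c \<le> c * 10 powr Q"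
    using r_pos by (simp add: mult.assoc[symmetric])
  then show ?thesis
    using c_ge_1 by (simp add: overlap_def field_simps power2_eq_square)
qed

lemma finite_nbrs: "finite (nbrs r A w)"
  using finite_A by (simp add: nbrs_def)

lemma card_nbrs_le: "real (card (nbrs r A w)) \<le> overlap"
proof -
  have "dist w z < 4 * r" if "dist w y < 2 * r" "dist z y < 2 * r" for z y
    using that dist_triangle2[of w z y] by linarith
  then have "nbrs r A w \<subseteq> {z \<in> A. dist w z < 4 * r}"
    by (auto simp: nbrs_def)
  then have "card (nbrs r A w) \<le> card {z \<in> A. dist w z < 4 * r}"
    using finite_A by (intro card_mono) auto
  then show ?thesis
    using card_near_le[of w] by linarith
qed

definition osc :: "('a \<Rightarrow> real) \<Rightarrow> 'a \<Rightarrow> real" where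
  "osc a w = (\<Sum>z\<in>nbrs r A w. \<bar>a z - a w\<bar>)"

lemma interp_lipschitz: "\<exists>L. L-lipschitz_on UNIV (interp r A a)"
proof
  let ?L = "(1 + real (card A)) / r * (\<Sum>z\<in>A. \<bar>a z - 0\<bar>)"
  show "?L-lipschitz_on UNIV (interp r A a)"
  proof (rule lipschitz_onI)
    fix x y
    show "dist (interp r A a x) (interp r A a y) \<le> ?L * dist x y"
      unfolding dist_real_def using interp_diff_le[OF finite_A subset_refl r_pos covers _ covers, of y x a 0]
      by (simp add: dist_commute)
  qed (use r_pos in \<open>auto intro!: sum_nonneg mult_nonneg_nonneg divide_nonneg_nonneg\<close>)
qed

lemma interp_measurable: "interp r A a \<in> borel_measurable \<mu>"
  using interp_lipschitz lipschitz_on_continuous_on continuous_measurable by blast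

text \<open>
  Points within \<open>r\<close> of \<open>x\<close> are still within \<open>2r\<close> of \<open>w\<close>, hence any net point whose tent is nonzero at one of
  them is a neighbour of \<open>w\<close>. So \<open>interp_diff_le\<close> applies with \<open>W\<close> the set of neighbours and \<open>b\<close> the
  value at \<open>w\<close>.
\<close>

lemma Lip_interp_bounds:
  assumes w: "w \<in> A" "dist x w < r"
  shows "0 \<le> Lip (interp r A a) x" "Lip (interp r A a) x \<le> (1 + overlap) / r * osc a w"
proof -
  have far: "tent r z y = 0" if "z \<in> A - nbrs r A w" "dist y w < 2 * r" for z y
  proof (rule tent_eq_0[OF r_pos], rule ccontr)
    assume "\<not> 2 * r \<le> dist y z"
    then have "y \<in> ball w (2 * r) \<inter> ball z (2 * r)"
      using that by (simp add: dist_commute)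
    then show False
      using that by (auto simp: nbrs_def)
  qed
  have "\<bar>interp r A a y - interp r A a x\<bar> \<le> (1 + overlap) / r * osc a w * dist x y"
    if y: "dist x y < r" for y
  proof -
    have yw: "dist y w < 2 * r"
      using y w dist_triangle2[of y w x] by (simp add: dist_commute)
    have "\<bar>interp r A a y - interp r A a x\<bar>
        \<le> (1 + real (card (nbrs r A w))) / r * (\<Sum>z\<in>nbrs r A w. \<bar>a z - a w\<bar>) * dist x y"
      using yw w r_pos by (intro interp_diff_le finite_A covers far) (auto simp: nbrs_def)
    also have "\<dots> \<le> (1 + overlap) / r * osc a w * dist x y"
      unfolding osc_def using card_nbrs_le[of w] r_pos
      by (intro mult_right_mono divide_right_mono sum_nonneg) auto
    finally show ?thesis .
  qed
  moreover have "0 \<le> (1 + overlap) / r * osc a w"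
    using r_pos overlap_nonneg by (auto simp: osc_def intro!: sum_nonneg mult_nonneg_nonneg)
  ultimately show "0 \<le> Lip (interp r A a) x" "Lip (interp r A a) x \<le> (1 + overlap) / r * osc a w"
    using Lip_bounds[OF r_pos, of x "interp r A a"] by blast+
qed

lemma osc_nonneg: "0 \<le> osc a w"
  by (simp add: osc_def sum_nonneg)

text \<open>
  The integrand is at most \<open>((1 + overlap) osc a w / r)\<^sup>Q\<close> on the ball of radius \<open>r\<close> about \<open>w\<close>, whose measure is
  at most \<open>c r\<^sup>Q\<close>: this is where the exponent of the Poincare inequality has to agree with the
  dimension, since the powers of \<open>r\<close> cancel exactly.
\<close>

lemma integral_Lip_interp_le:
  "(\<integral>x. Lip (interp r A a) x powr Q \<partial>\<mu>)
     \<le> c * (1 + overlap) powr Q * overlap powr Q * (\<Sum>w\<in>A. \<Sum>z\<in>nbrs r A w. \<bar>a z - a w\<bar> powr Q)"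
proof -
  define K where "K = (\<lambda>w. ((1 + overlap) / r * osc a w) powr Q)"
  define h where "h = (\<lambda>x. \<Sum>w\<in>A. K w * indicator (ball w r) x)"
  have h_int: "integrable \<mu> h"
    unfolding h_def by auto
  have "(\<integral>x. Lip (interp r A a) x powr Q \<partial>\<mu>) \<le> (\<integral>x. h x \<partial>\<mu>)"
  proof (cases "integrable \<mu> (\<lambda>x. Lip (interp r A a) x powr Q)")
    case True
    then show ?thesis
    proof (rule integral_mono[OF _ h_int])
      fix x
      obtain w where w: "w \<in> A" "dist x w < r"
        using covers by blast
      have "Lip (interp r A a) x powr Q \<le> K w * indicator (ball w r) x"
        unfolding K_def using Lip_interp_bounds[OF w, of a] Q_pos w(2)
        by (auto simp: dist_commute intro!: powr_mono2)
      also have "\<dots> \<le> h x"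
        unfolding h_def using w finite_A by (intro member_le_sum) (auto simp: K_def)
      finally show "Lip (interp r A a) x powr Q \<le> h x" .
    qed
  next
    case False
    \<comment> \<open>the integral of a function that is not integrable is \<open>0\<close> by convention\<close>
    have "0 \<le> (\<integral>x. h x \<partial>\<mu>)"
      by (intro integral_nonneg_AE) (auto simp: h_def K_def intro!: sum_nonneg)
    then show ?thesis
      using False by (simp add: not_integrable_integral_eq)
  qed
  also have "\<dots> = (\<Sum>w\<in>A. K w * measure \<mu> (ball w r))"
    unfolding h_def by (subst Bochner_Integration.integral_sum) auto
  also have "\<dots> \<le> (\<Sum>w\<in>A. K w * (c * r powr Q))"
    using r_pos r_small by (intro sum_mono mult_left_mono ball_upper) (auto simp: K_def)
  also have "\<dots> = (\<Sum>w\<in>A. c * (1 + overlap) powr Q * osc a w powr Q)"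
  proof (rule sum.cong[OF refl])
    fix w
    have "K w * r powr Q = (1 + overlap) powr Q * osc a w powr Q"
      unfolding K_def using r_pos overlap_nonneg osc_nonneg[of a w] by (simp add: powr_mult powr_divide)
    then show "K w * (c * r powr Q) = c * (1 + overlap) powr Q * osc a w powr Q"
      by (metis mult.assoc mult.commute)
  qed
  also have "\<dots> \<le> (\<Sum>w\<in>A. c * (1 + overlap) powr Q * (overlap powr Q * (\<Sum>z\<in>nbrs r A w. \<bar>a z - a w\<bar> powr Q)))"
    unfolding osc_def using c_ge_1 Q_pos finite_nbrs card_nbrs_le
    by (intro sum_mono mult_left_mono sum_powr_le) auto
  finally show ?thesis
    by (simp add: sum_distrib_left mult.assoc)
qed

lemma tent_weight_le: "tent r z x / (\<Sum>z\<in>A. tent r z x) \<le> indicator (ball z (2 * r)) x"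
  if "z \<in> A"
proof (cases "dist x z < 2 * r")
  case True
  have "tent r z x \<le> (\<Sum>z\<in>A. tent r z x)"
    using finite_A that by (intro member_le_sum tent_nonneg)
  then show ?thesis
    using True sum_tent_ge_1[OF finite_A r_pos covers, of x] by (simp add: dist_commute)
next
  case False
  then show ?thesis
    using tent_eq_0[OF r_pos, of x z] by (simp add: indicator_def)
qed

lemma abs_interp_le: "\<bar>interp r A a x\<bar> \<le> (\<Sum>z\<in>A. \<bar>a z\<bar> * indicator (ball z (2 * r)) x)"
proof -
  have "interp r A a x = (\<Sum>z\<in>A. a z * (tent r z x / (\<Sum>z\<in>A. tent r z x)))"
    by (simp add: interp_def sum_divide_distrib)
  also have "\<bar>\<dots>\<bar> \<le> (\<Sum>z\<in>A. \<bar>a z\<bar> * \<bar>tent r z x / (\<Sum>z\<in>A. tent r z x)\<bar>)"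
    unfolding abs_mult[symmetric] by (rule sum_abs)
  also have "\<dots> \<le> (\<Sum>z\<in>A. \<bar>a z\<bar> * indicator (ball z (2 * r)) x)"
    using tent_weight_le by (intro sum_mono mult_left_mono) (auto simp: abs_of_nonneg tent_nonneg sum_nonneg)
  finally show ?thesis .
qed

lemma bound_integrable:
  fixes a :: "'a \<Rightarrow> real"
  shows "integrable \<mu> (\<lambda>x. \<Sum>z\<in>A. \<bar>a z\<bar> * indicator (ball z (2 * r)) x)"
  by (intro Bochner_Integration.integrable_sum integrable_mult_right integrable_ball)

lemma interp_integrable: "integrable \<mu> (interp r A a)"
  by (rule Bochner_Integration.integrable_bound[OF bound_integrable[of a] interp_measurable])
    (auto intro!: AE_I2 order_trans[OF abs_interp_le] abs_ge_self)

text \<open>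
  Each average is paid for by the integral of \<open>|f|\<close> over its own ball, and a point lies in at most
  \<open>overlap\<close> of these balls.
\<close>

lemma integral_abs_net_smoothing_le:
  assumes f: "integrable \<mu> f"
  shows "(\<integral>x. \<bar>net_smoothing \<mu> r A f x\<bar> \<partial>\<mu>) \<le> overlap * (\<integral>x. \<bar>f x\<bar> \<partial>\<mu>)"
proof -
  let ?a = "\<lambda>z. mean \<mu> (ball z (2 * r)) f"
  have f_ball: "integrable \<mu> (\<lambda>x. indicator (ball z (2 * r)) x * \<bar>f x\<bar>)" for z
    using integrable_mult_indicator[OF ball_sets integrable_abs[OF f]] by simp
  have "(\<integral>x. \<bar>net_smoothing \<mu> r A f x\<bar> \<partial>\<mu>) \<le> (\<integral>x. (\<Sum>z\<in>A. \<bar>?a z\<bar> * indicator (ball z (2 * r)) x) \<partial>\<mu>)"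
    unfolding net_smoothing_def
    by (intro integral_mono bound_integrable abs_interp_le integrable_abs interp_integrable)
  also have "\<dots> = (\<Sum>z\<in>A. \<bar>?a z\<bar> * measure \<mu> (ball z (2 * r)))"
    by (subst Bochner_Integration.integral_sum) auto
  also have "\<dots> \<le> (\<Sum>z\<in>A. \<integral>x. indicator (ball z (2 * r)) x * \<bar>f x\<bar> \<partial>\<mu>)"
  proof (rule sum_mono)
    fix z
    have "\<bar>?a z\<bar> * measure \<mu> (ball z (2 * r)) \<le> \<bar>\<integral>x. indicator (ball z (2 * r)) x * f x \<partial>\<mu>\<bar>"
      by (simp add: mean_def set_lebesgue_integral_def abs_mult)
    also have "\<dots> \<le> (\<integral>x. \<bar>indicator (ball z (2 * r)) x * f x\<bar> \<partial>\<mu>)"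
      by (rule integral_abs_bound)
    also have "\<dots> = (\<integral>x. indicator (ball z (2 * r)) x * \<bar>f x\<bar> \<partial>\<mu>)"
      by (simp add: abs_mult)
    finally show "\<bar>?a z\<bar> * measure \<mu> (ball z (2 * r)) \<le> (\<integral>x. indicator (ball z (2 * r)) x * \<bar>f x\<bar> \<partial>\<mu>)" .
  qed
  also have "\<dots> = (\<integral>x. (\<Sum>z\<in>A. indicator (ball z (2 * r)) x * \<bar>f x\<bar>) \<partial>\<mu>)"
    by (rule Bochner_Integration.integral_sum[symmetric]) (rule f_ball)
  also have "\<dots> \<le> (\<integral>x. overlap * \<bar>f x\<bar> \<partial>\<mu>)"
  proof (rule integral_mono)
    fix x
    have "(\<Sum>z\<in>A. indicator (ball z (2 * r)) x :: real) = real (card {z \<in> A. dist x z < 2 * r})"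
      using finite_A by (simp add: sum.If_cases indicator_def dist_commute Int_def)
    also have "\<dots> \<le> real (card {z \<in> A. dist x z < 4 * r})"
      using finite_A r_pos by (intro of_nat_mono card_mono) auto
    also have "\<dots> \<le> overlap"
      by (rule card_near_le)
    finally show "(\<Sum>z\<in>A. indicator (ball z (2 * r)) x * \<bar>f x\<bar>) \<le> overlap * \<bar>f x\<bar>"
      by (simp add: sum_distrib_right[symmetric] mult_right_mono)
  qed (use f f_ball in auto)
  finally show ?thesis by simp
qed

lemma mean_lipschitz_close:
  assumes g: "L-lipschitz_on UNIV g" "integrable \<mu> g" and xz: "dist x z < 2 * r"
  shows "\<bar>mean \<mu> (ball z (2 * r)) g - g x\<bar> \<le> 4 * L * r"
proof -
  let ?B = "ball z (2 * r)"
  have "0 < inverse c * (2 * r) powr Q"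
    using c_ge_1 r_pos by simp
  then have pos: "0 < measure \<mu> ?B"
    using ball_lower[of "2 * r" z] r_pos r_small by linarith
  have L: "0 \<le> L"
    using g(1) by (rule lipschitz_on_nonneg)
  have gB: "integrable \<mu> (\<lambda>y. indicator ?B y * g y)"
    using integrable_mult_indicator[OF ball_sets g(2)] by simp
  have split: "indicator ?B y * (g y - g x) = indicator ?B y * g y - g x * indicator ?B y" for y
    by (simp add: right_diff_distrib)
  have "(\<integral>y. indicator ?B y * (g y - g x) \<partial>\<mu>)
      = (\<integral>y. indicator ?B y * g y \<partial>\<mu>) - g x * measure \<mu> ?B"
    unfolding split using gB by (subst Bochner_Integration.integral_diff) auto
  then have "mean \<mu> ?B g - g x = (\<integral>y. indicator ?B y * (g y - g x) \<partial>\<mu>) / measure \<mu> ?B"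
    using pos by (simp add: mean_def set_lebesgue_integral_def field_simps)
  moreover have "\<bar>\<integral>y. indicator ?B y * (g y - g x) \<partial>\<mu>\<bar> \<le> 4 * L * r * measure \<mu> ?B"
  proof -
    have "\<bar>\<integral>y. indicator ?B y * (g y - g x) \<partial>\<mu>\<bar> \<le> (\<integral>y. \<bar>indicator ?B y * (g y - g x)\<bar> \<partial>\<mu>)"
      by (rule integral_abs_bound)
    also have "\<dots> \<le> (\<integral>y. 4 * L * r * indicator ?B y \<partial>\<mu>)"
    proof (rule integral_mono)
      show "integrable \<mu> (\<lambda>y. \<bar>indicator ?B y * (g y - g x)\<bar>)"
        unfolding split using gB by auto
      show "\<bar>indicator ?B y * (g y - g x)\<bar> \<le> 4 * L * r * indicator ?B y" for y
      proof (cases "y \<in> ?B")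
        case True
        then have "dist y x \<le> 4 * r"
          using xz dist_triangle2[of y x z] by (simp add: dist_commute)
        then have "L * dist y x \<le> L * (4 * r)"
          using L by (rule mult_left_mono)
        then show ?thesis
          using True lipschitz_onD[OF g(1), of y x] by (simp add: dist_real_def)
      qed simp
    qed auto
    also have "\<dots> = 4 * L * r * measure \<mu> ?B"
      by simp
    finally show ?thesis .
  qed
  ultimately show ?thesis
    using pos by (simp add: pos_divide_le_eq)
qed

lemma net_smoothing_lipschitz_close:
  assumes g: "L-lipschitz_on UNIV g" "integrable \<mu> g"
  shows "\<bar>net_smoothing \<mu> r A g x - g x\<bar> \<le> 4 * L * r"
proof -
  let ?W = "{z \<in> A. dist x z < 2 * r}"
  let ?S = "\<Sum>z\<in>?W. tent r z x"
  let ?a = "\<lambda>z. mean \<mu> (ball z (2 * r)) g"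
  have S: "1 \<le> (\<Sum>z\<in>A. tent r z x)"
    by (rule sum_tent_ge_1[OF finite_A r_pos covers])
  have far: "tent r z x = 0" if "z \<in> A - ?W" for z
    using that by (intro tent_eq_0 r_pos) auto
  have W: "?W \<subseteq> A" by auto
  have SW: "1 \<le> ?S"
    using S interp_diff_const(2)[OF finite_A W _ far] by simp
  have eq: "net_smoothing \<mu> r A g x - g x = (\<Sum>z\<in>?W. (?a z - g x) * (tent r z x / ?S))"
    unfolding net_smoothing_def using S by (intro interp_diff_const(1)[OF finite_A W _ far]) simp
  have "\<bar>net_smoothing \<mu> r A g x - g x\<bar> \<le> (\<Sum>z\<in>?W. \<bar>(?a z - g x) * (tent r z x / ?S)\<bar>)"
    unfolding eq by (rule sum_abs)
  also have "\<dots> \<le> (\<Sum>z\<in>?W. 4 * L * r * (tent r z x / ?S))"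
  proof (rule sum_mono)
    fix z assume z: "z \<in> ?W"
    have "0 \<le> tent r z x / ?S"
      by (intro divide_nonneg_nonneg tent_nonneg sum_nonneg)
    moreover have "\<bar>?a z - g x\<bar> \<le> 4 * L * r"
      using mean_lipschitz_close[OF g] z by blast
    ultimately show "\<bar>(?a z - g x) * (tent r z x / ?S)\<bar> \<le> 4 * L * r * (tent r z x / ?S)"
      unfolding abs_mult abs_of_nonneg[OF \<open>0 \<le> tent r z x / ?S\<close>] by (rule mult_right_mono[rotated])
  qed
  also have "\<dots> = 4 * L * r"
    unfolding sum_distrib_left[symmetric] sum_divide_distrib[symmetric] using SW by simp
  finally show ?thesis .
qed

lemma net_smoothing_diff:
  assumes "integrable \<mu> f" "integrable \<mu> g"
  shows "net_smoothing \<mu> r A (\<lambda>x. f x - g x) x = net_smoothing \<mu> r A f x - net_smoothing \<mu> r A g x"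
proof -
  have "mean \<mu> (ball z (2 * r)) (\<lambda>x. f x - g x) = mean \<mu> (ball z (2 * r)) f - mean \<mu> (ball z (2 * r)) g" for z
    using integrable_mult_indicator[OF ball_sets assms(1), of z "2 * r"]
      integrable_mult_indicator[OF ball_sets assms(2), of z "2 * r"]
    by (simp add: mean_def set_lebesgue_integral_def right_diff_distrib diff_divide_distrib)
  then show ?thesis
    by (simp add: net_smoothing_def interp_def left_diff_distrib sum_subtractf diff_divide_distrib)
qed

text \<open>
  With \<open>g\<close> a Lipschitz function close to \<open>f\<close> in \<open>L\<^sup>1\<close>, split the error into the smoothing of \<open>f - g\<close>, the
  difference \<open>f - g\<close> itself, and the uniformly small error for \<open>g\<close>.
\<close>

lemma net_smoothing_error_le:
  assumes f: "integrable \<mu> f" and g: "L-lipschitz_on UNIV g" "integrable \<mu> g"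
  shows "(\<integral>x. \<bar>net_smoothing \<mu> r A f x - f x\<bar> \<partial>\<mu>) \<le> (overlap + 1) * (\<integral>x. \<bar>f x - g x\<bar> \<partial>\<mu>) + 4 * L * r * measure \<mu> UNIV"
proof -
  let ?d = "\<lambda>x. f x - g x"
  have d: "integrable \<mu> ?d" using f g by simp
  have sd: "integrable \<mu> (net_smoothing \<mu> r A ?d)" by (simp add: net_smoothing_def interp_integrable)
  have "(\<integral>x. \<bar>net_smoothing \<mu> r A f x - f x\<bar> \<partial>\<mu>) \<le> (\<integral>x. \<bar>net_smoothing \<mu> r A ?d x\<bar> + \<bar>?d x\<bar> + 4 * L * r \<partial>\<mu>)"
  proof (rule integral_mono)
    have "integrable \<mu> (\<lambda>x. net_smoothing \<mu> r A f x - f x)"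
      unfolding net_smoothing_def by (intro Bochner_Integration.integrable_diff f interp_integrable)
    then show "integrable \<mu> (\<lambda>x. \<bar>net_smoothing \<mu> r A f x - f x\<bar>)" by (rule integrable_abs)
    show "\<bar>net_smoothing \<mu> r A f x - f x\<bar> \<le> \<bar>net_smoothing \<mu> r A ?d x\<bar> + \<bar>?d x\<bar> + 4 * L * r" for x
      using net_smoothing_diff[OF f g(2), of x] net_smoothing_lipschitz_close[OF g, of x] by linarith
  qed (use d sd in auto)
  also have "\<dots> = (\<integral>x. \<bar>net_smoothing \<mu> r A ?d x\<bar> \<partial>\<mu>) + (\<integral>x. \<bar>?d x\<bar> \<partial>\<mu>) + 4 * L * r * measure \<mu> UNIV"
    using d sd by (simp add: space_\<mu>)
  also have "\<dots> \<le> (overlap + 1) * (\<integral>x. \<bar>?d x\<bar> \<partial>\<mu>) + 4 * L * r * measure \<mu> UNIV"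
    using integral_abs_net_smoothing_le[OF d] by (simp add: algebra_simps)
  finally show ?thesis .
qed

end

lemma (in regular_space) net_smoothing_tendsto:
  fixes \<rho> :: "nat \<Rightarrow> real" and A :: "nat \<Rightarrow> 'a set"
  assumes net: "\<forall>\<^sub>F n in sequentially. fine_net \<mu> Q c (\<rho> n) (A n)"
    and \<rho>: "\<rho> \<longlonglongrightarrow> 0" and f: "integrable \<mu> f"
  shows "(\<lambda>n. \<integral>x. \<bar>net_smoothing \<mu> (\<rho> n) (A n) f x - f x\<bar> \<partial>\<mu>) \<longlonglongrightarrow> 0"
proof (rule order_tendstoI)
  fix e :: real assume e: "0 < e"
  have ov: "0 < overlap + 1"
    using overlap_nonneg by simp
  then have "0 < e / (2 * (overlap + 1))"
    using e by simp
  moreover have "lipschitz_approximable \<mu> f"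
    using integrable_imp_lipschitz_approximable[OF _ sets_\<mu> f] finite_measure_axioms by blast
  ultimately obtain g L where g: "L-lipschitz_on UNIV g" "integrable \<mu> g"
      "(\<integral>x. \<bar>f x - g x\<bar> \<partial>\<mu>) < e / (2 * (overlap + 1))"
    unfolding lipschitz_approximable_def by meson
  have "(\<lambda>n. 4 * L * \<rho> n * measure \<mu> UNIV) \<longlonglongrightarrow> 4 * L * 0 * measure \<mu> UNIV"
    by (intro tendsto_intros \<rho>)
  then have "\<forall>\<^sub>F n in sequentially. 4 * L * \<rho> n * measure \<mu> UNIV < e / 2"
    using e by (intro order_tendstoD(2)) auto
  with net show "\<forall>\<^sub>F n in sequentially.
      (\<integral>x. \<bar>net_smoothing \<mu> (\<rho> n) (A n) f x - f x\<bar> \<partial>\<mu>) < e"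
  proof eventually_elim
    case (elim n)
    have "(\<integral>x. \<bar>net_smoothing \<mu> (\<rho> n) (A n) f x - f x\<bar> \<partial>\<mu>)
        \<le> (overlap + 1) * (\<integral>x. \<bar>f x - g x\<bar> \<partial>\<mu>) + 4 * L * \<rho> n * measure \<mu> UNIV"
      by (rule fine_net.net_smoothing_error_le[OF elim(1) f g(1,2)])
    also have "(overlap + 1) * (\<integral>x. \<bar>f x - g x\<bar> \<partial>\<mu>) < e / 2"
      using g(3) ov by (simp add: field_simps)
    finally show ?case
      using elim(2) by simp
  qed
next
  fix e :: real assume "e < 0"
  moreover have "0 \<le> (\<integral>x. \<bar>net_smoothing \<mu> (\<rho> n) (A n) f x - f x\<bar> \<partial>\<mu>)" for n
    by simp
  ultimately show "\<forall>\<^sub>F n in sequentially.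
      e < (\<integral>x. \<bar>net_smoothing \<mu> (\<rho> n) (A n) f x - f x\<bar> \<partial>\<mu>)"
    by (intro always_eventually allI) (rule less_le_trans)
qed

text \<open>
  The triangle inequality through \<open>u\<close>; the factor \<open>2\<close> occurs because the two means also differ by
  at most the mean of \<open>|u - f|\<close>.
\<close>

lemma (in regular_space) integral_abs_diff_mean_le:
  assumes f: "integrable \<mu> f" and u: "integrable \<mu> u" and pos: "0 < measure \<mu> UNIV"
  shows "(\<integral>x. \<bar>f x - mean \<mu> UNIV f\<bar> \<partial>\<mu>)
    \<le> 2 * (\<integral>x. \<bar>u x - f x\<bar> \<partial>\<mu>) + measure \<mu> UNIV * mean \<mu> UNIV (\<lambda>x. \<bar>u x - mean \<mu> UNIV u\<bar>)"
proof -
  let ?m = "measure \<mu> UNIV"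
  let ?d = "\<bar>mean \<mu> UNIV u - mean \<mu> UNIV f\<bar>"
  have mean: "mean \<mu> UNIV g = (\<integral>x. g x \<partial>\<mu>) / ?m" for g
    by (simp add: mean_def set_lebesgue_integral_def)
  have "(\<integral>x. u x \<partial>\<mu>) - (\<integral>x. f x \<partial>\<mu>) = (\<integral>x. u x - f x \<partial>\<mu>)"
    using f u by simp
  then have "?m * ?d = \<bar>\<integral>x. u x - f x \<partial>\<mu>\<bar>"
    using pos by (simp add: mean abs_mult[symmetric] diff_divide_distrib[symmetric])
  also have "\<dots> \<le> (\<integral>x. \<bar>u x - f x\<bar> \<partial>\<mu>)"
    by (rule integral_abs_bound)
  finally have d: "?m * ?d \<le> (\<integral>x. \<bar>u x - f x\<bar> \<partial>\<mu>)" .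
  have "(\<integral>x. \<bar>f x - mean \<mu> UNIV f\<bar> \<partial>\<mu>)
      \<le> (\<integral>x. \<bar>u x - f x\<bar> + \<bar>u x - mean \<mu> UNIV u\<bar> + ?d \<partial>\<mu>)"
    using f u by (intro integral_mono) auto
  also have "\<dots> = (\<integral>x. \<bar>u x - f x\<bar> \<partial>\<mu>) + (\<integral>x. \<bar>u x - mean \<mu> UNIV u\<bar> \<partial>\<mu>) + ?m * ?d"
    using f u by (simp add: space_\<mu>)
  also have "(\<integral>x. \<bar>u x - mean \<mu> UNIV u\<bar> \<partial>\<mu>) = ?m * mean \<mu> UNIV (\<lambda>x. \<bar>u x - mean \<mu> UNIV u\<bar>)"
    using pos by (simp add: mean[of "\<lambda>x. \<bar>u x - mean \<mu> UNIV u\<bar>"])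
  finally show ?thesis
    using d by linarith
qed

section \<open>Energy of the levels of the filling\<close>

text \<open>
  Every edge arises from two ordered pairs, according to whether the first entry is its initial or its
  terminal vertex. On each of the two classes of pairs the map to edges is injective.
\<close>

lemma sum_ordered_pairs_le:
  fixes q B :: real
  assumes orient: "edge_orientation E src tgt"
    and A: "finite A" "inj_on v A" and nb: "\<And>w. w \<in> A \<Longrightarrow> nb w \<subseteq> A"
    and E: "\<And>w z. w \<in> A \<Longrightarrow> z \<in> nb w \<Longrightarrow> z \<noteq> w \<Longrightarrow> {v w, v z} \<in> E"
    and bound: "\<And>F. finite F \<Longrightarrow> F \<subseteq> {{v w, v z} | w z. w \<in> A \<and> z \<in> A} \<inter> E \<Longrightarrow>
      (\<Sum>e\<in>F. \<bar>differential src tgt u e\<bar> powr q) \<le> B"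
  shows "(\<Sum>w\<in>A. \<Sum>z\<in>nb w. \<bar>u (v z) - u (v w)\<bar> powr q) \<le> 2 * B"
proof -
  define P where "P = {(w, z). w \<in> A \<and> z \<in> nb w \<and> z \<noteq> w}"
  define e where "e = (\<lambda>(w, z). {v w, v z})"
  define h where "h = (\<lambda>(w, z). \<bar>u (v z) - u (v w)\<bar> powr q)"
  define P1 where "P1 = {x \<in> P. src (e x) = v (fst x)}"
  define P2 where "P2 = {x \<in> P. tgt (e x) = v (fst x)}"
  have P_sub: "P \<subseteq> A \<times> A"
    using nb by (auto simp: P_def)
  have fin: "finite P" "finite P1" "finite P2"
    using finite_subset[OF P_sub] A(1) by (auto simp: P1_def P2_def)
  have ends: "e x = {src (e x), tgt (e x)}" "v (fst x) \<noteq> v (snd x)" "e x \<in> E" if "x \<in> P" for x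
  proof -
    show "e x \<in> E"
      using that E by (auto simp: P_def e_def)
    then show "e x = {src (e x), tgt (e x)}"
      using orient unfolding edge_orientation_def by blast
    have "fst x \<in> A" "snd x \<in> A" "fst x \<noteq> snd x"
      using that subsetD[OF nb[of "fst x"], of "snd x"] by (auto simp: P_def)
    then show "v (fst x) \<noteq> v (snd x)"
      by (simp add: inj_on_eq_iff[OF A(2)])
  qed
  have h: "h x = \<bar>differential src tgt u (e x)\<bar> powr q" if "x \<in> P" for x
    using ends[OF that] by (cases x) (auto simp: h_def e_def differential_def doubleton_eq_iff abs_minus_commute)
  have P12: "P = P1 \<union> P2"
  proof
    show "P \<subseteq> P1 \<union> P2"
    proof
      fix x assume x: "x \<in> P"
      have "v (fst x) \<in> e x"
        by (auto simp: e_def split: prod.splits)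
      then have "v (fst x) = src (e x) \<or> v (fst x) = tgt (e x)"
        using ends(1)[OF x] by blast
      then show "x \<in> P1 \<union> P2"
        using x by (auto simp: P1_def P2_def)
    qed
  qed (auto simp: P1_def P2_def)
  have eqI: "x = y" if "x \<in> P" "y \<in> P" "e x = e y" "v (fst x) = v (fst y)" for x y
  proof -
    have "v (snd x) = v (snd y)"
      using that by (auto simp: e_def doubleton_eq_iff split: prod.splits)
    moreover have "x \<in> A \<times> A" "y \<in> A \<times> A"
      using that(1,2) P_sub by blast+
    ultimately show ?thesis
      using that(4) by (auto simp: inj_on_eq_iff[OF A(2)])
  qed
  have inj: "inj_on e P1" "inj_on e P2"
    by (rule inj_onI, rule eqI; auto simp: P1_def P2_def)+
  have part: "(\<Sum>x\<in>P'. h x) \<le> B" if "P' \<subseteq> P" "finite P'" "inj_on e P'" for P'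
  proof -
    have "(\<Sum>x\<in>P'. h x) = (\<Sum>x\<in>P'. \<bar>differential src tgt u (e x)\<bar> powr q)"
      using that h by (intro sum.cong) auto
    also have "\<dots> = (\<Sum>a\<in>e ` P'. \<bar>differential src tgt u a\<bar> powr q)"
      using that by (simp add: sum.reindex)
    also have "\<dots> \<le> B"
    proof (rule bound)
      show "e ` P' \<subseteq> {{v w, v z} | w z. w \<in> A \<and> z \<in> A} \<inter> E"
        using that ends(3) P_sub by (fastforce simp: e_def)
    qed (use that in auto)
    finally show ?thesis .
  qed
  have "(\<Sum>w\<in>A. \<Sum>z\<in>nb w. \<bar>u (v z) - u (v w)\<bar> powr q) = (\<Sum>x\<in>Sigma A nb. h x)"
    using A(1) finite_subset[OF nb A(1)] by (subst sum.Sigma) (auto simp: h_def)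
  also have "\<dots> = (\<Sum>x\<in>P. h x)"
  proof (rule sum.mono_neutral_right)
    show "finite (Sigma A nb)"
      using A(1) finite_subset[OF nb A(1)] by blast
  qed (auto simp: P_def h_def)
  also have "\<dots> \<le> (\<Sum>x\<in>P1. h x) + (\<Sum>x\<in>P2. h x)"
  proof -
    have "(\<Sum>x\<in>P1 \<union> P2. h x) = (\<Sum>x\<in>P1. h x) + (\<Sum>x\<in>P2. h x) - (\<Sum>x\<in>P1 \<inter> P2. h x)"
      using fin by (simp add: sum_Un)
    moreover have "0 \<le> (\<Sum>x\<in>P1 \<inter> P2. h x)"
      by (intro sum_nonneg) (auto simp: h_def)
    ultimately show ?thesis using P12 by simp
  qed
  also have "\<dots> \<le> B + B"
    using fin inj by (intro add_mono part) (auto simp: P1_def P2_def)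
  finally show ?thesis by simp
qed

lemma finite_edge_set_eventually_avoided:
  assumes "finite B" "B \<subseteq> edges N"
  shows "\<forall>\<^sub>F n in sequentially. \<forall>w z. {Cell n w, Cell n z} \<notin> B"
proof -
  have "finite (\<Union>B)"
    using assms by (force simp: edges_def)
  then have "finite (level ` \<Union>B)" by simp
  then obtain k where "\<forall>l\<in>level ` \<Union>B. l < k"
    using finite_nat_set_iff_bounded by blast
  then have k: "level v < k" if "v \<in> \<Union>B" for v
    using that by blast
  have "{Cell n w, Cell n z} \<notin> B" if "k \<le> n" for n w z
    using that k[of "Cell n w"] by auto
  then show ?thesis
    by (auto simp: eventually_sequentially)
qed

lemma powi_radius: "2 powi (1 - int n) = 2 * (2::real) powi (- int n)"
  by (simp add: power_int_diff power_int_minus field_simps)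

text \<open>
  For every \<open>T > 0\<close> the finitely many edges with value above \<open>T\<close> miss all deep levels. Below them
  \<open>weak_lp_sum_le\<close> bounds the energy by a multiple of \<open>T\<^sup>q\<^sup>-\<^sup>p\<close>, and \<open>T\<close> is arbitrary.
\<close>

lemma energy_tendsto_0:
  fixes N :: "nat \<Rightarrow> 'a::metric_space set" and p q :: real
  assumes pq: "0 < p" "p < q" and N: "\<And>n. 1 \<le> n \<Longrightarrow> finite (N n)"
    and orient: "edge_orientation (edges N) src tgt"
    and weak: "differential src tgt u \<in> weak_lp p (edges N)"
  shows "(\<lambda>n. \<Sum>w\<in>N n. \<Sum>z\<in>nbrs (2 powi (- int n)) (N n) w.
      \<bar>u (Cell n z) - u (Cell n w)\<bar> powr q) \<longlonglongrightarrow> 0"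
    (is "?S \<longlonglongrightarrow> 0")
proof -
  let ?d = "differential src tgt u"
  obtain C where C: "0 \<le> C"
      "\<And>t. 0 < t \<Longrightarrow> finite {e \<in> edges N. \<bar>?d e\<bar> > t}"
      "\<And>t. 0 < t \<Longrightarrow> real (card {e \<in> edges N. \<bar>?d e\<bar> > t}) \<le> (C / t) powr p"
    using weak unfolding weak_lp_def by auto
  define K where "K = (2 * C) powr p / (1 - 2 powr (p - q))"
  have K: "0 \<le> K"
    using pq powr_less_mono[of "p - q" 0 2] by (simp add: K_def)
  have le: "\<forall>\<^sub>F n in sequentially. ?S n \<le> 2 * (K * T powr (q - p))" if T: "0 < T" for T
    using finite_edge_set_eventually_avoided[OF C(2)[OF T] Collect_restrict] eventually_ge_at_top[of 1]
  proof eventually_elim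
    case (elim n)
    show ?case
    proof (rule sum_ordered_pairs_le[OF orient, where v = "Cell n"])
      show "finite (N n)" "inj_on (Cell n) (N n)"
        using N elim(2) by (auto simp: inj_on_def)
      show "nbrs (2 powi (- int n)) (N n) w \<subseteq> N n" for w
        by (auto simp: nbrs_def)
      show "{Cell n w, Cell n z} \<in> edges N"
        if "w \<in> N n" "z \<in> nbrs (2 powi (- int n)) (N n) w" "z \<noteq> w" for w z
      proof -
        have "z \<in> N n" "vset (Cell n w) \<inter> vset (Cell n z) \<noteq> {}"
          using that by (simp_all only: nbrs_def mem_Collect_eq vset.simps powi_radius simp_thms)
        moreover have "Cell n w \<in> vertices N" "Cell n z \<in> vertices N"
          using that elim(2) \<open>z \<in> N n\<close> by (auto simp: vertices_def)
        ultimately show ?thesis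
          unfolding edges_def using that(3)
          by (intro CollectI exI[of _ "Cell n w"] exI[of _ "Cell n z"] conjI) auto
      qed
      fix F assume F: "finite F"
        "F \<subseteq> {{Cell n w, Cell n z} | w z. w \<in> N n \<and> z \<in> N n} \<inter> edges N"
      show "(\<Sum>e\<in>F. \<bar>?d e\<bar> powr q) \<le> K * T powr (q - p)"
        unfolding K_def
      proof (rule weak_lp_sum_le[OF pq C(1) C(3) C(2) F(1) _ T])
        show "\<bar>?d e\<bar> \<le> T" if "e \<in> F" for e
          using that F(2) elim(1) by fastforce
      qed (use F(2) in auto)
    qed
  qed
  show ?thesis
  proof (rule order_tendstoI)
    fix a :: real assume "a < 0"
    moreover have "0 \<le> ?S n" for n
      by (intro sum_nonneg) simp
    ultimately show "\<forall>\<^sub>F n in sequentially. a < ?S n"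
      by (intro always_eventually allI) (rule less_le_trans)
  next
    fix a :: real assume a: "0 < a"
    \<comment> \<open>chosen such that \<open>T\<^sup>q\<^sup>-\<^sup>p = b\<close> and \<open>2 K b < a\<close>, even if \<open>K = 0\<close>\<close>
    define b where "b = a / (4 * K + 2)"
    define T where "T = b powr (1 / (q - p))"
    have "0 < b"
      using a K by (simp add: b_def)
    then have "0 < T"
      by (simp add: T_def)
    have "T powr (q - p) = b"
      unfolding T_def using \<open>0 < b\<close> pq by (simp add: powr_powr)
    moreover have "b * (4 * K + 2) = a"
      using K by (simp add: b_def)
    moreover have "0 \<le> K * b"
      using K \<open>0 < b\<close> by simp
    ultimately have "2 * (K * T powr (q - p)) < a"
      using \<open>0 < b\<close> by (simp add: algebra_simps)
    then show "\<forall>\<^sub>F n in sequentially. ?S n < a"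
      using le[OF \<open>0 < T\<close>] by (auto elim: eventually_mono)
  qed
qed

section \<open>Triviality of the space below the critical exponent\<close>

lemma ahlfors_regular_finite_measure:
  fixes \<mu> :: "'a::metric_space measure"
  assumes compact: "compact (UNIV :: 'a set)" and sets: "sets \<mu> = sets borel"
    and reg: "ahlfors_regular \<mu> Q"
  shows "finite_measure \<mu>"
proof (rule finite_measureI)
  obtain c where c: "\<And>z. emeasure \<mu> (ball z 1) \<le> ennreal (c * 1 powr Q)"
    using reg unfolding ahlfors_regular_def by (metis less_numeral_extra(1) order_refl)
  obtain k where k: "finite k" "(UNIV :: 'a set) \<subseteq> (\<Union>z\<in>k. ball z 1)"
    using compact compact_eq_totally_bounded[of "UNIV :: 'a set"] zero_less_one by metis
  have "emeasure \<mu> (space \<mu>) \<le> emeasure \<mu> (\<Union>z\<in>k. ball z 1)"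
    using k by (intro emeasure_mono) (auto simp: sets)
  also have "\<dots> \<le> (\<Sum>z\<in>k. emeasure \<mu> (ball z 1))"
    using k by (intro emeasure_subadditive_finite) (auto simp: sets)
  also have "\<dots> \<le> (\<Sum>z\<in>k. ennreal (c * 1 powr Q))"
    by (intro sum_mono c)
  also have "\<dots> < \<infinity>"
    by (simp add: ennreal_mult_less_top of_nat_less_top)
  finally show "emeasure \<mu> (space \<mu>) \<noteq> \<infinity>" by simp
qed

theorem proposition5p5:
  fixes \<mu> :: "'a::metric_space measure"
    and Q p :: real
    and N :: "nat \<Rightarrow> 'a set"
    and src tgt :: "'a vertex set \<Rightarrow> 'a vertex"
  assumes "1 < Q"
    and "compact (UNIV :: 'a set)"
    and "diameter (UNIV :: 'a set) = 1"
    and "sets \<mu> = sets borel"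
    and "ahlfors_regular \<mu> Q"
    and "poincare_inequality \<mu> Q"
    and "filling_nets N"
    and "edge_orientation (edges N) src tgt"
    and "1 < p" and "p < Q"
  shows "\<forall>f \<in> A_dot \<mu> N src tgt p. \<exists>c. AE x in \<mu>. f x = c"
proof
  fix f assume "f \<in> A_dot \<mu> N src tgt p"
  then have f: "integrable \<mu> f"
    and weak: "differential src tgt (poisson_extension \<mu> f) \<in> weak_lp p (edges N)"
    by (auto simp: A_dot_def)
  interpret finite_measure \<mu>
    by (rule ahlfors_regular_finite_measure[OF assms(2,4,5)])
  obtain c where "1 \<le> c" and c: "\<And>z r. 0 < r \<Longrightarrow> r \<le> 1 \<Longrightarrow>
        ennreal (inverse c * r powr Q) \<le> emeasure \<mu> (ball z r) \<and>
        emeasure \<mu> (ball z r) \<le> ennreal (c * r powr Q)"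
    using assms(5) unfolding ahlfors_regular_def by blast
  interpret regular_space \<mu> Q c
  proof
    fix z and \<rho> :: real assume \<rho>: "0 < \<rho>" "\<rho> \<le> 1"
    show "inverse c * \<rho> powr Q \<le> measure \<mu> (ball z \<rho>)" "measure \<mu> (ball z \<rho>) \<le> c * \<rho> powr Q"
      using c[OF \<rho>, of z] \<open>1 \<le> c\<close> by (simp_all add: emeasure_eq_measure)
  qed (use assms \<open>1 \<le> c\<close> in auto)
  obtain C \<Lambda> where C: "0 \<le> C" "1 \<le> \<Lambda>" and poincare: "\<And>u z R L. L-lipschitz_on UNIV u \<Longrightarrow> 0 < R \<Longrightarrow>
        mean \<mu> (ball z R) (\<lambda>x. \<bar>u x - mean \<mu> (ball z R) u\<bar>)
          \<le> C * R * (mean \<mu> (ball z (\<Lambda> * R)) (\<lambda>x. Lip u x powr Q)) powr (1 / Q)"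
    using assms(6) unfolding poincare_inequality_def by metis
  define \<rho> :: "nat \<Rightarrow> real" where "\<rho> n = 2 powi (- int n)" for n
  define u where "u n = net_smoothing \<mu> (\<rho> n) (N n) f" for n
  define S where "S n = (\<Sum>w\<in>N n. \<Sum>z\<in>nbrs (\<rho> n) (N n) w.
    \<bar>poisson_extension \<mu> f (Cell n z) - poisson_extension \<mu> f (Cell n w)\<bar> powr Q)" for n
  define m where "m = measure \<mu> UNIV"
  define K where "K = c * (1 + overlap) powr Q * overlap powr Q"
  have \<rho>_pos: "0 < \<rho> n" for n
    by (simp add: \<rho>_def)
  have \<rho>_eq: "\<rho> n = (1 / 2) ^ n" for n
    by (simp add: \<rho>_def power_int_minus power_one_over inverse_eq_divide)
  have \<rho>_lim: "\<rho> \<longlonglongrightarrow> 0"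
    unfolding \<rho>_eq by (rule LIMSEQ_power_zero) simp
  have maximal: "maximal_separated (\<rho> n) (N n)" if "1 \<le> n" for n
    using assms(7) that by (simp add: filling_nets_def \<rho>_def)
  have N_fin: "finite (N n)" if "1 \<le> n" for n
    using maximal[OF that] separated_finite[OF assms(2) _ \<rho>_pos] by (auto simp: maximal_separated_def)
  have net: "fine_net \<mu> Q c (\<rho> n) (N n)" if "3 \<le> n" for n
  proof unfold_locales
    show "\<exists>z\<in>N n. dist x z < \<rho> n" for x
      using maximal_separated_covers[OF maximal \<rho>_pos] that by simp
    have "\<rho> n \<le> (1 / 2) ^ 3"
      unfolding \<rho>_eq using that by (intro power_decreasing) auto
    then show "5 * \<rho> n \<le> 1" by (simp add: power3_eq_cube)
  qed (use maximal N_fin \<rho>_pos that in \<open>auto simp: maximal_separated_def\<close>)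
  have dist_le: "dist x y \<le> 1" for x y :: 'a
    using diameter_bounded_bound[OF compact_imp_bounded[OF assms(2)], of x y] assms(3) by simp
  \<comment> \<open>a ball of radius \<open>2\<close>, and its enlargement, is the whole space, so one instance of the Poincare
    inequality controls the distance of \<open>u n\<close> from a constant\<close>
  have whole: "ball z R = UNIV" if "1 < R" for z :: 'a and R
    using le_less_trans[OF dist_le that] by auto
  have m: "0 < m"
  proof -
    have "0 < inverse c * 1 powr Q"
      using \<open>1 \<le> c\<close> by simp
    also have "\<dots> \<le> measure \<mu> (ball undefined 1)"
      by (rule ball_lower) auto
    also have "\<dots> \<le> m"
      unfolding m_def by (intro finite_measure_mono) (auto simp: assms(4))
    finally show ?thesis .
  qed
  have mean_UNIV: "mean \<mu> UNIV g = (\<integral>x. g x \<partial>\<mu>) / m" for g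
    by (simp add: mean_def set_lebesgue_integral_def m_def)
  have bound: "(\<integral>x. \<bar>f x - mean \<mu> UNIV f\<bar> \<partial>\<mu>)
      \<le> 2 * (\<integral>x. \<bar>u n x - f x\<bar> \<partial>\<mu>) + m * (C * 2 * (K * S n / m) powr (1 / Q))"
    if n: "3 \<le> n" for n
  proof -
    interpret fine_net \<mu> Q c "\<rho> n" "N n"
      by (rule net[OF n])
    let ?a = "\<lambda>z. mean \<mu> (ball z (2 * \<rho> n)) f"
    have u: "u n = interp (\<rho> n) (N n) ?a"
      by (simp add: u_def net_smoothing_def)
    have S: "S n = (\<Sum>w\<in>N n. \<Sum>z\<in>nbrs (\<rho> n) (N n) w. \<bar>?a z - ?a w\<bar> powr Q)"
      by (simp add: S_def poisson_extension_def powi_radius \<rho>_def)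
    obtain L where L: "L-lipschitz_on UNIV (u n)"
      unfolding u using interp_lipschitz by blast
    have "mean \<mu> UNIV (\<lambda>x. \<bar>u n x - mean \<mu> UNIV (u n)\<bar>)
        \<le> C * 2 * (mean \<mu> UNIV (\<lambda>x. Lip (u n) x powr Q)) powr (1 / Q)"
      using poincare[OF L, of 2 undefined] whole[of 2 undefined] whole[of "\<Lambda> * 2" undefined] C by simp
    also have "\<dots> \<le> C * 2 * (K * S n / m) powr (1 / Q)"
    proof (intro mult_left_mono powr_mono2)
      show "mean \<mu> UNIV (\<lambda>x. Lip (u n) x powr Q) \<le> K * S n / m"
        unfolding mean_UNIV u S K_def using m by (intro divide_right_mono integral_Lip_interp_le) simp
      show "0 \<le> mean \<mu> UNIV (\<lambda>x. Lip (u n) x powr Q)"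
        unfolding mean_UNIV using m by simp
    qed (use C assms(1) in auto)
    finally have "m * mean \<mu> UNIV (\<lambda>x. \<bar>u n x - mean \<mu> UNIV (u n)\<bar>)
        \<le> m * (C * 2 * (K * S n / m) powr (1 / Q))"
      using m by simp
    moreover have "integrable \<mu> (u n)"
      unfolding u by (rule interp_integrable)
    ultimately show ?thesis
      using integral_abs_diff_mean_le[OF f _ m[unfolded m_def], of "u n", folded m_def] by linarith
  qed
  have "(\<lambda>n. \<integral>x. \<bar>u n x - f x\<bar> \<partial>\<mu>) \<longlonglongrightarrow> 0"
    unfolding u_def using net by (intro net_smoothing_tendsto \<rho>_lim f) (auto simp: eventually_sequentially)
  moreover have "(\<lambda>n. (K * S n / m) powr (1 / Q)) \<longlonglongrightarrow> 0"
  proof -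
    have "S \<longlonglongrightarrow> 0"
      unfolding S_def \<rho>_def using assms N_fin weak by (intro energy_tendsto_0) auto
    then have "(\<lambda>n. K * S n / m) \<longlonglongrightarrow> K * 0 / m"
      using m by (intro tendsto_intros) auto
    moreover have "0 \<le> K * S n / m" for n
      using m \<open>1 \<le> c\<close> by (auto simp: K_def S_def intro!: mult_nonneg_nonneg sum_nonneg divide_nonneg_nonneg)
    ultimately show ?thesis
      using assms(1) by (intro tendsto_zero_powrI[of _ _ _ "1 / Q"]) auto
  qed
  ultimately have lim: "(\<lambda>n. 2 * (\<integral>x. \<bar>u n x - f x\<bar> \<partial>\<mu>) + m * (C * 2 * (K * S n / m) powr (1 / Q)))
      \<longlonglongrightarrow> 2 * 0 + m * (C * 2 * 0)"
    by (intro tendsto_intros)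
  have "(\<integral>x. \<bar>f x - mean \<mu> UNIV f\<bar> \<partial>\<mu>) \<le> 2 * 0 + m * (C * 2 * 0)"
    using bound by (intro LIMSEQ_le_const[OF lim]) blast
  then have "(\<integral>x. \<bar>f x - mean \<mu> UNIV f\<bar> \<partial>\<mu>) = 0"
    by (simp add: antisym)
  then have "AE x in \<mu>. \<bar>f x - mean \<mu> UNIV f\<bar> = 0"
    using f by (subst (asm) integral_nonneg_eq_0_iff_AE) auto
  then show "\<exists>c. AE x in \<mu>. f x = c"
    by (auto elim: eventually_mono)
qed

end
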